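(* Let $(X,d)$ be a metric space, $\mathcal{M}$ its maximal-clique cover and $P$ a persistent clique partition of $X$. Then the persistence modules of the Vietoris–Rips filtration and of the quotient Vietoris–Rips filtration, $H_*\mathrm{CoNrv}\,\mathcal{M}$ and $H_*\mathrm{CoNrv}(\mathcal{M}/P)$, are $3$-approximated.
   Context: $\mathbb{R}_+=[0,\infty)$. A subset $M\subseteq X$ is an $r$-clique if $\mathrm{diam}(M)\le r$, and is maximal if not properly contained in another $r$-clique. $\mathcal{M}(r)$ is the cover of $X$ by all maximal $r$-cliques. A persistent clique partition $P$ of $X$ assigns to each $r\in\mathbb{R}_+$ a partition $P(r)$ of $X$ (into nonempty blocks) such that every block $C\in P(r)$ has $\mathrm{diam}(C)\le r$, and for $s\le t$ every block of $P(s)$ is contained in a block of $P(t)$. Let $q_r:X\to X/P(r)$ be the projection to the set of blocks, and for $r\le s$ let $\pi_{r,s}:X/P(r)\to X/P(s)$ send a block to the block containing it. The quotient cover is $(\mathcal{M}/P)(r)=\{q_r(M)\}_{M\in\mathcal{M}(r)}$, a cover of $X/P(r)$. The co-nerve of a cover $\mathcal{U}=\{U_i\}_{i\in I}$ of a set $Y$ is the simplicial complex $\mathrm{CoNrv}(\mathcal{U})$ whose simplices are the finite nonempty $\sigma\subseteq Y$ with $\sigma\subseteq U_i$ for some $i$. $\mathrm{CoNrv}(\mathcal{M}(r))$ is the Vietoris–Rips complex at scale $r$. $H_*$ is simplicial homology with coefficients in a fixed field. The structure maps of $H_*\mathrm{CoNrv}\,\mathcal{M}$ are induced by the inclusions $\mathrm{CoNrv}(\mathcal{M}(r))\subseteq\mathrm{CoNrv}(\mathcal{M}(s))$,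 and those of $H_*\mathrm{CoNrv}(\mathcal{M}/P)$ by the simplicial maps $\mathrm{CoNrv}((\mathcal{M}/P)(r))\to\mathrm{CoNrv}((\mathcal{M}/P)(s))$ given on vertices by $\pi_{r,s}$. A persistence module is a functor from $(\mathbb{R}_+,\le)$ to vector spaces. Persistence modules $F,G$ are $c$-approximated ($c\ge1$) if there are natural transformations $\phi:F\Rightarrow G\circ S_c$ and $\psi:G\Rightarrow F\circ S_c$, with $S_c(r)=cr$, such that $\psi_{cr}\circ\phi_r=F(r\le c^2r)$ and $\phi_{cr}\circ\psi_r=G(r\le c^2r)$ for all $r$. *)

theory Defs
  imports
    "HOL-Analysis.Abstract_Metric_Spaces"
    "HOL-Library.Disjoint_Sets"
    "HOL-Library.Extended_Nonnegative_Real"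
    "HOL-Library.Poly_Mapping"
    "HOL-Algebra.AbelCoset"
    "Jordan_Normal_Form.VS_Connect"
begin

section \<open>Cliques, covers and quotient covers\<close>

text \<open>The diameter is extended-real valued, so that unbounded sets have diameter \<open>\<infinity>\<close>;
  the empty set has diameter 0.\<close>

definition diam :: "('a \<Rightarrow> 'a \<Rightarrow> real) \<Rightarrow> 'a set \<Rightarrow> ennreal" where
  "diam d A = (SUP x\<in>A. SUP y\<in>A. ennreal (d x y))"

definition clique :: "'a set \<Rightarrow> ('a \<Rightarrow> 'a \<Rightarrow> real) \<Rightarrow> real \<Rightarrow> 'a set \<Rightarrow> bool" where
  "clique X d r M \<longleftrightarrow> M \<subseteq> X \<and> diam d M \<le> ennreal r"

definition max_clique_cover :: "'a set \<Rightarrow> ('a \<Rightarrow> 'a \<Rightarrow> real) \<Rightarrow> real \<Rightarrow> 'a set set" where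
  "max_clique_cover X d r = {M. clique X d r M \<and> \<not> (\<exists>N. clique X d r N \<and> M \<subset> N)}"

definition persistent_clique_partition ::
  "'a set \<Rightarrow> ('a \<Rightarrow> 'a \<Rightarrow> real) \<Rightarrow> (real \<Rightarrow> 'a set set) \<Rightarrow> bool" where
  "persistent_clique_partition X d P \<longleftrightarrow>
     (\<forall>r\<ge>0. partition_on X (P r) \<and> (\<forall>C\<in>P r. diam d C \<le> ennreal r)) \<and>
     (\<forall>s t. 0 \<le> s \<and> s \<le> t \<longrightarrow> (\<forall>C\<in>P s. \<exists>D\<in>P t. C \<subseteq> D))"

text \<open>The set of blocks \<open>X/P(r)\<close> is \<open>P r\<close> itself; \<open>block_of P r\<close> is the projection
  \<open>q\<^sub>r\<close> and \<open>block_map P r s\<close> is \<open>\<pi>\<^sub>r\<^sub>,\<^sub>s\<close>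
  (whose values do not depend on \<open>r\<close>, only its domain does).\<close>

definition block_of :: "(real \<Rightarrow> 'a set set) \<Rightarrow> real \<Rightarrow> 'a \<Rightarrow> 'a set" where
  "block_of P r x = (THE C. C \<in> P r \<and> x \<in> C)"

definition block_map :: "(real \<Rightarrow> 'a set set) \<Rightarrow> real \<Rightarrow> real \<Rightarrow> 'a set \<Rightarrow> 'a set" where
  "block_map P r s C = (THE D. D \<in> P s \<and> C \<subseteq> D)"

definition quotient_cover ::
  "(real \<Rightarrow> 'a set set) \<Rightarrow> (real \<Rightarrow> 'a set set) \<Rightarrow> real \<Rightarrow> 'a set set set" where
  "quotient_cover \<M> P r = (\<lambda>M. block_of P r ` M) ` \<M> r"

definition conerve :: "'v set set \<Rightarrow> 'v set set" where
  "conerve \<U> = {\<sigma>. finite \<sigma> \<and> \<sigma> \<noteq> {} \<and> (\<exists>U\<in>\<U>. \<sigma> \<subseteq> U)}"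


section \<open>Simplicial homology with coefficients in a field\<close>

text \<open>Oriented simplicial chains. A simplicial complex is given by its set of simplices, and an
  \<open>n\<close>-chain is a finitely supported function on orderings \<open>v\<^sub>0, \<dots>, v\<^sub>n\<close> of the \<open>n\<close>-simplices that
  takes opposite values on opposite orientations, i.e. that changes sign when two vertices are
  interchanged. The generator \<open>[v\<^sub>0, \<dots>, v\<^sub>n]\<close> is the function \<open>oriented_simplex\<close> below.\<close>

definition chain_scale :: "'k::field \<Rightarrow> ('v list \<Rightarrow>\<^sub>0 'k) \<Rightarrow> ('v list \<Rightarrow>\<^sub>0 'k)" where
  "chain_scale a c = Poly_Mapping.map ((*) a) c"

definition chains :: "nat \<Rightarrow> 'v set set \<Rightarrow> ('v list \<Rightarrow>\<^sub>0 'k::field) set" where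
  "chains n K = {c.
     (\<forall>v\<in>Poly_Mapping.keys c. length v = Suc n \<and> distinct v \<and> set v \<in> K) \<and>
     (\<forall>v i j. i < j \<and> j < length v \<longrightarrow>
        Poly_Mapping.lookup c (v[i := v ! j, j := v ! i]) = - Poly_Mapping.lookup c v)}"

definition oriented_simplex :: "'v list \<Rightarrow> ('v list \<Rightarrow>\<^sub>0 'k::field)" where
  "oriented_simplex v = (\<Sum>p | p permutes {0..<length v}.
     Poly_Mapping.single (permute_list p v) (of_int (sign p)))"

lemma oriented_simplex_in_chains:
  assumes "length v = Suc n" "distinct v" "set v \<in> K"
  shows "(oriented_simplex v :: 'v list \<Rightarrow>\<^sub>0 'k::field) \<in> chains n K"
proof -
  let ?c = "oriented_simplex v :: 'v list \<Rightarrow>\<^sub>0 'k"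
  have lookup: "Poly_Mapping.lookup ?c w =
      (\<Sum>p | p permutes {0..<length v}. of_int (sign p) when permute_list p v = w)" for w
    by (simp add: oriented_simplex_def lookup_sum lookup_single)
  have keys: "\<exists>p. p permutes {0..<length v} \<and> permute_list p v = w"
    if "w \<in> Poly_Mapping.keys ?c" for w
  proof (rule ccontr)
    assume "\<not> ?thesis"
    then have "Poly_Mapping.lookup ?c w = 0" unfolding lookup by (intro sum.neutral) auto
    with that show False by (simp add: in_keys_iff)
  qed
  have swap: "Poly_Mapping.lookup ?c (w[i := w ! j, j := w ! i]) = - Poly_Mapping.lookup ?c w"
    if ij: "i < j" "j < length w" for w i j
  proof (cases "length w = length v")
    case False
    then show ?thesis using keys[of w] keys[of "w[i := w ! j, j := w ! i]"]
      by (metis add.inverse_neutral in_keys_iff length_list_update length_permute_list)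
  next
    case True
    let ?t = "Transposition.transpose i j"
    have t: "?t permutes {0..<length v}" using ij True by (intro permutes_swap_id) auto
    have w: "w[i := w ! j, j := w ! i] = permute_list ?t w"
      using ij by (intro nth_equalityI)
        (auto simp: permute_list_def nth_list_update Transposition.transpose_def)
    have tt: "permute_list ?t (permute_list ?t u) = u" if "length u = length v" for u :: "'v list"
      using that t permute_list_compose[of ?t u ?t] by (simp add: atLeast0LessThan)
    have eq: "permute_list (p \<circ> ?t) v = permute_list ?t w \<longleftrightarrow> permute_list p v = w"
      if "p permutes {0..<length v}" for p
      using tt[of w] tt[of "permute_list p v"] True t permute_list_compose[of ?t v p] that
      by (metis atLeast0LessThan length_permute_list)
    have sgn: "sign (p \<circ> ?t) = - sign p" if "p permutes {0..<length v}" for p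
      using that t ij
      by (simp add: sign_compose sign_swap_id permutes_imp_permutation[of "{0..<length v}"])
    have "Poly_Mapping.lookup ?c (permute_list ?t w) = (\<Sum>p | p permutes {0..<length v}.
        of_int (sign (p \<circ> ?t)) when permute_list (p \<circ> ?t) v = permute_list ?t w)"
      unfolding lookup by (rule sum_permutations_compose_right[OF t])
    also have "\<dots> = - Poly_Mapping.lookup ?c w"
      unfolding lookup sum_negf[symmetric]
      by (intro sum.cong) (auto simp: eq sgn when_def)
    finally show ?thesis by (simp add: w)
  qed
  have "length w = Suc n \<and> distinct w \<and> set w \<in> K" if "w \<in> Poly_Mapping.keys ?c" for w
    using keys[OF that] assms by (auto simp: atLeast0LessThan)
  then show ?thesis using swap by (auto simp: chains_def)
qed

text \<open>The boundary \<open>\<partial>\<^sub>n\<close>. On chains that alternate in this way the usual formula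
  \<open>\<partial>\<^sub>n [v\<^sub>0, \<dots>, v\<^sub>n] = (\<Sum>i\<le>n. (-1)\<^sup>i [v\<^sub>0, \<dots>, v\<^sub>i\<^sub>-\<^sub>1, v\<^sub>i\<^sub>+\<^sub>1, \<dots>, v\<^sub>n])\<close> becomes
  \<open>(\<partial>\<^sub>n c)(w) = (\<Sum>x. c (x # w))\<close>: the vertex \<open>v\<^sub>i\<close> moves to the front at the cost of the sign
  \<open>(-1)\<^sup>i\<close>. See lemma \<open>boundary_oriented_simplex\<close>. Homology is unreduced, so \<open>\<partial>\<^sub>0 = 0\<close>.\<close>

definition boundary :: "nat \<Rightarrow> ('v list \<Rightarrow>\<^sub>0 'k::field) \<Rightarrow> ('v list \<Rightarrow>\<^sub>0 'k)" where
  "boundary n c = (if n = 0 then 0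
     else \<Sum>v\<in>Poly_Mapping.keys c. Poly_Mapping.single (tl v) (Poly_Mapping.lookup c v))"

lemma sum_keys_single_sum:
  fixes c :: "'i \<Rightarrow> 'k::field"
  shows "(\<Sum>v\<in>Poly_Mapping.keys (\<Sum>p\<in>A. Poly_Mapping.single (g p) (c p)).
      Poly_Mapping.single (f v) (Poly_Mapping.lookup (\<Sum>p\<in>A. Poly_Mapping.single (g p) (c p)) v))
    = (\<Sum>p\<in>A. Poly_Mapping.single (f (g p)) (c p))"
proof -
  let ?L = "\<lambda>b. \<Sum>v\<in>Poly_Mapping.keys b. Poly_Mapping.single (f v) (Poly_Mapping.lookup b v :: 'k)"
  have L: "?L b = (\<Sum>v\<in>S. Poly_Mapping.single (f v) (Poly_Mapping.lookup b v))"
    if "finite S" "Poly_Mapping.keys b \<subseteq> S" for b S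
    using that by (intro sum.mono_neutral_left) (auto simp: in_keys_iff)
  have add: "?L (a + b) = ?L a + ?L b" for a b
    using Poly_Mapping.keys_add[of a b]
    by (subst (1 2 3) L[of "Poly_Mapping.keys a \<union> Poly_Mapping.keys b"])
       (auto simp: lookup_add single_add sum.distrib)
  have single: "?L (Poly_Mapping.single w a) = Poly_Mapping.single (f w) a" for w a
    by (cases "a = 0") auto
  show ?thesis
    by (induction A rule: infinite_finite_induct) (auto simp: add single)
qed

lemma chain_scale_sum_single:
  "chain_scale a (\<Sum>p\<in>A. Poly_Mapping.single (g p) (c p)) =
    (\<Sum>p\<in>A. Poly_Mapping.single (g p) (a * c p))"
proof -
  have lookup: "Poly_Mapping.lookup (chain_scale a b) k = a * Poly_Mapping.lookup b k" for b k
    by (auto simp: chain_scale_def map.rep_eq when_def)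
  have add: "chain_scale a (b + b') = chain_scale a b + chain_scale a b'" for b b'
    by (rule poly_mapping_eqI) (simp add: lookup lookup_add distrib_left)
  have single: "chain_scale a (Poly_Mapping.single w x) = Poly_Mapping.single w (a * x)" for w x
    by (rule poly_mapping_eqI) (auto simp: chain_scale_def map.rep_eq lookup_single when_def)
  have zero: "chain_scale a 0 = 0"
    by (rule poly_mapping_eqI) (auto simp: chain_scale_def map.rep_eq)
  show ?thesis
    by (induction A rule: infinite_finite_induct) (auto simp: add single zero)
qed

lemma boundary_oriented_simplex:
  assumes "length v = Suc n" and "n > 0"
  shows "boundary n (oriented_simplex v :: 'v list \<Rightarrow>\<^sub>0 'k::field) =
    (\<Sum>i\<le>n. chain_scale ((-1) ^ i) (oriented_simplex (take i v @ drop (Suc i) v)))"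
proof -
  have ins: "permute_list (permutation_insert 0 i q) v
      = v ! i # permute_list q (take i v @ drop (Suc i) v)"
    if "i \<le> n" "q permutes {0..<n}" for i q
  proof (rule nth_equalityI)
    show "length (permute_list (permutation_insert 0 i q) v)
      = length (v ! i # permute_list q (take i v @ drop (Suc i) v))"
      using that assms by simp
    fix k assume "k < length (permute_list (permutation_insert 0 i q) v)"
    then have k: "k < Suc n" using assms by simp
    show "permute_list (permutation_insert 0 i q) v ! k
      = (v ! i # permute_list q (take i v @ drop (Suc i) v)) ! k"
    proof (cases k)
      case 0
      then show ?thesis using k assms by (simp add: permute_list_def nth_append)
    next
      case (Suc j)
      have "q j < n" using that(2) k Suc permutes_in_image[OF that(2), of j] by simp
      then show ?thesis using k assms Suc that
        by (auto simp: permute_list_def permutation_insert_expand nth_append simp del: upt_Suc)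
    qed
  qed
  have bij: "bij_betw (\<lambda>(i, q). permutation_insert 0 i q) ({..n} \<times> {q. q permutes {0..<n}})
      {p. p permutes {0..<Suc n}}"
  proof (rule bij_betwI[where g = "\<lambda>p. (p 0, permutation_delete p 0)"])
    show "(\<lambda>(i, q). permutation_insert 0 i q) \<in>
        {..n} \<times> {q. q permutes {0..<n}} \<rightarrow> {p. p permutes {0..<Suc n}}"
      by (auto intro!: permutation_insert_permutes)
    show "(\<lambda>p. (p 0, permutation_delete p 0)) \<in>
        {p. p permutes {0..<Suc n}} \<rightarrow> {..n} \<times> {q. q permutes {0..<n}}"
    proof (intro funcsetI)
      fix p :: "nat \<Rightarrow> nat" assume "p \<in> {p. p permutes {0..<Suc n}}"
      then have p: "p permutes {0..<Suc n}" by simp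
      show "(p 0, permutation_delete p 0) \<in> {..n} \<times> {q. q permutes {0..<n}}"
        using permutes_in_image[OF p, of 0] permutation_delete_permutes[OF p, of 0] by auto
    qed
    show "(\<lambda>p. (p 0, permutation_delete p 0)) ((\<lambda>(i, q). permutation_insert 0 i q) x) = x"
      if "x \<in> {..n} \<times> {q. q permutes {0..<n}}" for x
      by (cases x) (auto simp: permutation_insert_expand permutation_delete_expand)
    show "(\<lambda>(i, q). permutation_insert 0 i q) ((\<lambda>p. (p 0, permutation_delete p 0)) p) = p"
      if "p \<in> {p. p permutes {0..<Suc n}}" for p
      using that permutation_insert_delete[of p n 0] by auto
  qed
  have sgn: "(of_int (sign (permutation_insert 0 i q)) :: 'k) = (-1) ^ i * of_int (sign q)"
    if "i \<le> n" "q permutes {0..<n}" for i q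
    using signof_permutation_insert[OF that(2), of 0 i, where 'a='k] that(1) by simp
  have "boundary n (oriented_simplex v :: 'v list \<Rightarrow>\<^sub>0 'k) =
      (\<Sum>p | p permutes {0..<Suc n}. Poly_Mapping.single (tl (permute_list p v)) (of_int (sign p)))"
    using assms by (simp add: boundary_def oriented_simplex_def sum_keys_single_sum)
  also have "\<dots> = (\<Sum>(i, q) \<in> {..n} \<times> {q. q permutes {0..<n}}.
      Poly_Mapping.single (permute_list q (take i v @ drop (Suc i) v)) ((-1) ^ i * of_int (sign q)))"
    by (rule sum.reindex_bij_betw[OF bij, symmetric, THEN trans])
       (auto intro!: sum.cong simp: ins sgn)
  also have "\<dots> = (\<Sum>i\<le>n. chain_scale ((-1) ^ i) (oriented_simplex (take i v @ drop (Suc i) v)))"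
    using assms by (simp add: sum.cartesian_product[symmetric] oriented_simplex_def chain_scale_sum_single)
  finally show ?thesis .
qed

text \<open>The chain map of a vertex map sends \<open>[v\<^sub>0, \<dots>, v\<^sub>n]\<close> to \<open>[f v\<^sub>0, \<dots>, f v\<^sub>n]\<close>, see lemma
  \<open>chain_map_oriented_simplex\<close>; the latter is 0 when the \<open>f v\<^sub>i\<close> are not distinct.\<close>

definition chain_map :: "('v \<Rightarrow> 'w) \<Rightarrow> ('v list \<Rightarrow>\<^sub>0 'k::field) \<Rightarrow> ('w list \<Rightarrow>\<^sub>0 'k)" where
  "chain_map f c =
     (\<Sum>v\<in>Poly_Mapping.keys c. Poly_Mapping.single (map f v) (Poly_Mapping.lookup c v))"

lemma chain_map_oriented_simplex:
  "chain_map f (oriented_simplex v :: 'v list \<Rightarrow>\<^sub>0 'k::field) = oriented_simplex (map f v)"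
  by (auto simp: chain_map_def oriented_simplex_def sum_keys_single_sum permute_list_map
      atLeast0LessThan intro!: sum.cong)

definition cycles :: "nat \<Rightarrow> 'v set set \<Rightarrow> ('k::field, 'v list \<Rightarrow>\<^sub>0 'k) module" where
  "cycles n K = \<lparr>carrier = {c \<in> chains n K. boundary n c = 0},
     mult = undefined, one = undefined, zero = 0, add = (+), smult = chain_scale\<rparr>"

definition boundaries :: "nat \<Rightarrow> 'v set set \<Rightarrow> ('v list \<Rightarrow>\<^sub>0 'k::field) set" where
  "boundaries n K = boundary (Suc n) ` chains (Suc n) K"

definition quotient_space :: "('k, 'm) module \<Rightarrow> 'm set \<Rightarrow> ('k, 'm set) module" where
  "quotient_space V U = \<lparr>carrier = a_rcosets\<^bsub>V\<^esub> U, mult = undefined, one = undefined,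
     zero = U, add = set_add V,
     smult = (\<lambda>a A. \<Union>x\<in>A. U +>\<^bsub>V\<^esub> (a \<odot>\<^bsub>V\<^esub> x))\<rparr>"

definition homology :: "nat \<Rightarrow> 'v set set \<Rightarrow> ('k::field, ('v list \<Rightarrow>\<^sub>0 'k) set) module" where
  "homology n K = quotient_space (cycles n K) (boundaries n K)"

text \<open>The map \<open>H\<^sub>n(K) \<rightarrow> H\<^sub>n(L)\<close> induced by a simplicial map: all representatives of a class are
  sent into one coset, of which the union is taken.\<close>

definition homology_map ::
  "nat \<Rightarrow> 'w set set \<Rightarrow> ('v \<Rightarrow> 'w) \<Rightarrow> ('v list \<Rightarrow>\<^sub>0 'k::field) set \<Rightarrow> ('w list \<Rightarrow>\<^sub>0 'k) set" where
  "homology_map n L f A = (\<Union>c\<in>A. boundaries n L +>\<^bsub>cycles n L\<^esub> chain_map f c)"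


section \<open>Persistence modules\<close>

text \<open>\<open>pspace F r\<close> is the vector space \<open>F(r)\<close> and \<open>pmap F r s\<close> the structure map
  \<open>F(r \<le> s)\<close>. Only parameters in \<open>[0, \<infinity>)\<close>, and values on carriers, are meaningful.\<close>

record ('k, 'm) pmodule =
  pspace :: "real \<Rightarrow> ('k, 'm) module"
  pmap :: "real \<Rightarrow> real \<Rightarrow> 'm \<Rightarrow> 'm"

definition persistence_module :: "('k::field, 'm) pmodule \<Rightarrow> bool" where
  "persistence_module F \<longleftrightarrow>
     (\<forall>r\<ge>0. vectorspace class_ring (pspace F r)) \<and>
     (\<forall>r s. 0 \<le> r \<and> r \<le> s \<longrightarrow> linear_map class_ring (pspace F r) (pspace F s) (pmap F r s)) \<and>
     (\<forall>r\<ge>0. \<forall>x\<in>carrier (pspace F r). pmap F r r x = x) \<and>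
     (\<forall>r s t. 0 \<le> r \<and> r \<le> s \<and> s \<le> t \<longrightarrow>
        (\<forall>x\<in>carrier (pspace F r). pmap F s t (pmap F r s x) = pmap F r t x))"

definition nat_trans ::
  "('k::field, 'm) pmodule \<Rightarrow> ('k, 'p) pmodule \<Rightarrow> (real \<Rightarrow> 'm \<Rightarrow> 'p) \<Rightarrow> bool" where
  "nat_trans F G \<phi> \<longleftrightarrow>
     (\<forall>r\<ge>0. linear_map class_ring (pspace F r) (pspace G r) (\<phi> r)) \<and>
     (\<forall>r s. 0 \<le> r \<and> r \<le> s \<longrightarrow>
        (\<forall>x\<in>carrier (pspace F r). \<phi> s (pmap F r s x) = pmap G r s (\<phi> r x)))"

text \<open>\<open>rescale c F\<close> is the composition \<open>F \<circ> S\<^sub>c\<close> with \<open>S\<^sub>c(r) = cr\<close>.\<close>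

definition rescale :: "real \<Rightarrow> ('k, 'm) pmodule \<Rightarrow> ('k, 'm) pmodule" where
  "rescale c F = \<lparr>pspace = (\<lambda>r. pspace F (c * r)), pmap = (\<lambda>r s. pmap F (c * r) (c * s))\<rparr>"

definition approximated ::
  "real \<Rightarrow> ('k::field, 'm) pmodule \<Rightarrow> ('k, 'p) pmodule \<Rightarrow> bool" where
  "approximated c F G \<longleftrightarrow> c \<ge> 1 \<and> persistence_module F \<and> persistence_module G \<and>
     (\<exists>\<phi> \<psi>. nat_trans F (rescale c G) \<phi> \<and> nat_trans G (rescale c F) \<psi> \<and>
       (\<forall>r\<ge>0. \<forall>x\<in>carrier (pspace F r). \<psi> (c * r) (\<phi> r x) = pmap F r (c\<^sup>2 * r) x) \<and>
       (\<forall>r\<ge>0. \<forall>y\<in>carrier (pspace G r). \<phi> (c * r) (\<psi> r y) = pmap G r (c\<^sup>2 * r) y))"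

text \<open>Degree \<open>n\<close> homology of a diagram of simplicial complexes \<open>K r\<close> whose simplicial maps
  \<open>K r \<rightarrow> K s\<close> are given on vertices by \<open>f r s\<close>.\<close>

definition persistent_homology ::
  "nat \<Rightarrow> (real \<Rightarrow> 'v set set) \<Rightarrow> (real \<Rightarrow> real \<Rightarrow> 'v \<Rightarrow> 'v) \<Rightarrow>
    ('k::field, ('v list \<Rightarrow>\<^sub>0 'k) set) pmodule" where
  "persistent_homology n K f =
     \<lparr>pspace = (\<lambda>r. homology n (K r)), pmap = (\<lambda>r s. homology_map n (K s) (f r s))\<rparr>"

definition VR_homology ::
  "nat \<Rightarrow> 'a set \<Rightarrow> ('a \<Rightarrow> 'a \<Rightarrow> real) \<Rightarrow> ('k::field, ('a list \<Rightarrow>\<^sub>0 'k) set) pmodule" where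
  "VR_homology n X d =
     persistent_homology n (\<lambda>r. conerve (max_clique_cover X d r)) (\<lambda>r s x. x)"

definition quotient_VR_homology ::
  "nat \<Rightarrow> 'a set \<Rightarrow> ('a \<Rightarrow> 'a \<Rightarrow> real) \<Rightarrow> (real \<Rightarrow> 'a set set) \<Rightarrow>
    ('k::field, ('a set list \<Rightarrow>\<^sub>0 'k) set) pmodule" where
  "quotient_VR_homology n X d P =
     persistent_homology n (\<lambda>r. conerve (quotient_cover (max_clique_cover X d) P r))
       (block_map P)"

end

theory Submission
  imports Defs
begin

text \<open>A vertex of the Vietoris--Rips complex at scale \<open>r\<close> is sent to its block at scale \<open>3r\<close>, and a
  block at scale \<open>r\<close> to an arbitrary representative. If two blocks at scale \<open>s\<close> meet a common
  \<open>r\<close>-clique, their points have distance at most \<open>2s + r\<close>, which is at most \<open>3s\<close> for \<open>r \<le> s\<close>;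
  this makes the second map simplicial and makes all squares and triangles of the approximation
  commute up to contiguity. It remains to see that contiguous maps agree on homology. Changing the
  image of a single vertex \<open>a\<close> from \<open>f a\<close> to \<open>f' a\<close> changes the image of a cycle \<open>c\<close> by the boundary of
  the double cone with apexes \<open>f a\<close> and \<open>f' a\<close> over the image of the link of \<open>a\<close> in \<open>c\<close>, which
  is itself a cycle; no ordering of the vertices and no division by integers is needed.\<close>

section \<open>Linear operators on chains\<close>

lemma lookup_chain_scale [simp]:
  "Poly_Mapping.lookup (chain_scale a c) v = a * Poly_Mapping.lookup c v"
  by (auto simp: chain_scale_def map.rep_eq when_def)

lemma chain_scale_add_right: "chain_scale a (b + c) = chain_scale a b + chain_scale a c"
  by (rule poly_mapping_eqI) (simp add: lookup_add algebra_simps)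

lemma chain_scale_add_left: "chain_scale (a + b) c = chain_scale a c + chain_scale b c"
  by (rule poly_mapping_eqI) (simp add: lookup_add algebra_simps)

lemma chain_scale_diff_right: "chain_scale a (b - c) = chain_scale a b - chain_scale a c"
  by (rule poly_mapping_eqI) (simp add: lookup_minus algebra_simps)

lemma chain_scale_scale [simp]: "chain_scale a (chain_scale b c) = chain_scale (a * b) c"
  by (rule poly_mapping_eqI) (simp add: algebra_simps)

lemma chain_scale_simps [simp]:
  "chain_scale 1 c = c" "chain_scale 0 c = 0" "chain_scale a 0 = 0"
  "chain_scale (- a) c = - chain_scale a c"
  "chain_scale a (- c) = - chain_scale a c"
  "chain_scale a (Poly_Mapping.single v b) = Poly_Mapping.single v (a * b)"
  by (auto intro!: poly_mapping_eqI simp: lookup_single when_def)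

lemma chain_scale_sum: "chain_scale a (\<Sum>i\<in>I. c i) = (\<Sum>i\<in>I. chain_scale a (c i))"
  by (induction I rule: infinite_finite_induct) (auto simp: chain_scale_add_right)

text \<open>Linear extension from lists to chains. The operators below are all of this form, so that
  linearity and composition are shown once.\<close>

definition lin :: "('v list \<Rightarrow> ('w list \<Rightarrow>\<^sub>0 'k)) \<Rightarrow> ('v list \<Rightarrow>\<^sub>0 'k::field) \<Rightarrow> ('w list \<Rightarrow>\<^sub>0 'k)" where
  "lin f c = (\<Sum>v\<in>Poly_Mapping.keys c. chain_scale (Poly_Mapping.lookup c v) (f v))"

lemma lin_superset:
  assumes "finite S" "Poly_Mapping.keys c \<subseteq> S"
  shows "lin f c = (\<Sum>v\<in>S. chain_scale (Poly_Mapping.lookup c v) (f v))"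
  unfolding lin_def using assms by (intro sum.mono_neutral_left) (auto simp: in_keys_iff)

lemma lin_add: "lin f (b + c) = lin f b + lin f c"
  using Poly_Mapping.keys_add[of b c]
  by (subst (1 2 3) lin_superset[of "Poly_Mapping.keys b \<union> Poly_Mapping.keys c"])
     (auto simp: lookup_add chain_scale_add_left sum.distrib)

lemma lin_zero [simp]: "lin f 0 = 0"
  by (simp add: lin_def)

lemma lin_scale: "lin f (chain_scale a c) = chain_scale a (lin f c)"
proof -
  have "Poly_Mapping.keys (chain_scale a c) \<subseteq> Poly_Mapping.keys c"
    by (auto simp: in_keys_iff)
  then show ?thesis
    by (subst lin_superset[of "Poly_Mapping.keys c"]) (auto simp: lin_def chain_scale_sum)
qed

lemma lin_uminus: "lin f (- c) = - lin f c"
  using lin_scale[of f "-1" c] by simp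

lemma lin_diff: "lin f (b - c) = lin f b - lin f c"
  using lin_add[of f b "- c"] by (simp add: lin_uminus)

lemma lin_sum: "lin f (\<Sum>i\<in>I. c i) = (\<Sum>i\<in>I. lin f (c i))"
  by (induction I rule: infinite_finite_induct) (auto simp: lin_add)

lemma lin_single [simp]: "lin f (Poly_Mapping.single v a) = chain_scale a (f v)"
  by (cases "a = 0") (auto simp: lin_def)

lemma lin_cong: "(\<And>v. v \<in> Poly_Mapping.keys c \<Longrightarrow> f v = g v) \<Longrightarrow> lin f c = lin g c"
  by (auto simp: lin_def intro!: sum.cong)

text \<open>A composite of linear extensions is again one, so identities between operators need
  checking only on single lists.\<close>

lemma lin_lin: "lin g (lin f c) = lin (\<lambda>v. lin g (f v)) c"
  unfolding lin_def[of f] lin_def[of "\<lambda>v. lin g (f v)"] by (simp add: lin_sum lin_scale)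

lemma lin_fun_diff: "lin (\<lambda>v. f v - g v) c = lin f c - lin g c"
  by (simp add: lin_def chain_scale_diff_right sum_subtractf)

lemma lin_fun_uminus: "lin (\<lambda>v. - f v) c = - lin f c"
  by (simp add: lin_def sum_negf)

lemma lin_fun_zero [simp]: "lin (\<lambda>v. 0) c = 0"
  by (simp add: lin_def)

lemma lin_id: "lin (\<lambda>v. Poly_Mapping.single v 1) c = c"
  by (rule poly_mapping_eqI)
     (auto simp: lin_def lookup_sum lookup_single when_def in_keys_iff)

lemma chain_map_eq_lin: "chain_map f = lin (\<lambda>v. Poly_Mapping.single (map f v) 1)"
  by (simp add: chain_map_def lin_def fun_eq_iff)

text \<open>Only the front vertex is removed: in an alternating chain the other faces come from the
  reorderings of the list. The empty list, which is its own tail, must go to 0.\<close>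

definition face :: "'v list \<Rightarrow> ('v list \<Rightarrow>\<^sub>0 'k::field)" where
  "face v = (if v = [] then 0 else Poly_Mapping.single (tl v) 1)"

text \<open>The boundary operator in all degrees at once; on 0-chains it is the augmentation, with
  values in the multiples of the empty list.\<close>

definition bd :: "('v list \<Rightarrow>\<^sub>0 'k::field) \<Rightarrow> ('v list \<Rightarrow>\<^sub>0 'k)" where
  "bd = lin face"

text \<open>Unlike a cone, this puts \<open>x\<close> only in front and does not preserve
  alternation; it serves the recursion for \<open>insertions\<close>.\<close>

definition prefix_chain :: "'v \<Rightarrow> ('v list \<Rightarrow>\<^sub>0 'k::field) \<Rightarrow> ('v list \<Rightarrow>\<^sub>0 'k)" where
  "prefix_chain x = lin (\<lambda>v. Poly_Mapping.single (x # v) 1)"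

text \<open>The cone over one ordering: \<open>a\<close> enters at every position, with a sign
  alternating by position, which makes the cone over an alternating chain alternating.\<close>

fun insertions :: "'v \<Rightarrow> 'v list \<Rightarrow> ('v list \<Rightarrow>\<^sub>0 'k::field)" where
  "insertions a [] = Poly_Mapping.single [a] 1"
| "insertions a (x # w) = Poly_Mapping.single (a # x # w) 1 - prefix_chain x (insertions a w)"

definition cone_chain :: "'v \<Rightarrow> ('v list \<Rightarrow>\<^sub>0 'k::field) \<Rightarrow> ('v list \<Rightarrow>\<^sub>0 'k)" where
  "cone_chain a = lin (insertions a)"

text \<open>For \<open>c\<close> in \<open>chains n K\<close> this is the chain \<open>l\<close>
  such that \<open>c\<close> is the cone from \<open>a\<close> over \<open>l\<close> plus simplices
  avoiding \<open>a\<close>; by alternation the lists with \<open>a\<close> in front determine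
  it.\<close>

definition link :: "'v \<Rightarrow> ('v list \<Rightarrow>\<^sub>0 'k::field) \<Rightarrow> ('v list \<Rightarrow>\<^sub>0 'k)" where
  "link a = lin (\<lambda>v. if v \<noteq> [] \<and> hd v = a then Poly_Mapping.single (tl v) 1 else 0)"

section \<open>Identities between boundary, cone, link and chain map\<close>

lemmas chain_op_defs = chain_map_eq_lin bd_def prefix_chain_def cone_chain_def link_def

lemma bd_linear: "bd (b + c) = bd b + bd c" "bd (b - c) = bd b - bd c" "bd 0 = 0"
  "bd (- c) = - bd c" "bd (chain_scale x c) = chain_scale x (bd c)"
  by (simp_all add: chain_op_defs lin_add lin_diff lin_uminus lin_scale)

lemma chain_map_linear: "chain_map f (b + c) = chain_map f b + chain_map f c"
  "chain_map f (b - c) = chain_map f b - chain_map f c" "chain_map f 0 = 0"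
  "chain_map f (- c) = - chain_map f c"
  "chain_map f (chain_scale x c) = chain_scale x (chain_map f c)"
  by (simp_all add: chain_op_defs lin_add lin_diff lin_uminus lin_scale)

lemma cone_linear: "cone_chain a (b + c) = cone_chain a b + cone_chain a c" "cone_chain a 0 = 0"
  "cone_chain a (b - c) = cone_chain a b - cone_chain a c"
  "cone_chain a (- c) = - cone_chain a c" "cone_chain a (chain_scale x c) = chain_scale x (cone_chain a c)"
  by (simp_all add: chain_op_defs lin_add lin_diff lin_uminus lin_scale)

lemma link_linear: "link a (b + c) = link a b + link a c"
  "link a (b - c) = link a b - link a c" "link a 0 = 0"
  "link a (- c) = - link a c" "link a (chain_scale x c) = chain_scale x (link a c)"
  by (simp_all add: chain_op_defs lin_add lin_diff lin_uminus lin_scale)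

lemma prefix_chain_linear:
  "prefix_chain a (b - c) = prefix_chain a b - prefix_chain a c" "prefix_chain a 0 = 0"
  "prefix_chain a (- c) = - prefix_chain a c"
  by (simp_all add: chain_op_defs lin_diff lin_uminus)

lemma prefix_chain_single [simp]:
  "prefix_chain x (Poly_Mapping.single w a) = Poly_Mapping.single (x # w) a"
  by (simp add: prefix_chain_def)

lemma bd_prefix_chain: "bd (prefix_chain x c) = c"
  by (simp add: chain_op_defs lin_lin face_def lin_id)

text \<open>The front insertion has boundary \<open>w\<close>. The other insertions keep the head of
  \<open>w\<close> in front, and removing it leaves the insertions into the tail.\<close>

lemma bd_insertions:
  "bd (insertions a w :: 'v list \<Rightarrow>\<^sub>0 'k::field) = Poly_Mapping.single w 1 - cone_chain a (face w)"
proof (cases w)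
  case Nil
  then show ?thesis by (simp add: bd_def face_def cone_chain_def)
next
  case (Cons x u)
  have "bd (Poly_Mapping.single (a # x # u) 1 :: 'v list \<Rightarrow>\<^sub>0 'k) = Poly_Mapping.single (x # u) 1"
    by (simp add: bd_def face_def)
  moreover have "cone_chain a (face w) = (insertions a u :: 'v list \<Rightarrow>\<^sub>0 'k)"
    by (simp add: Cons face_def cone_chain_def)
  ultimately show ?thesis
    unfolding Cons by (simp only: insertions.simps bd_linear bd_prefix_chain)
qed

text \<open>The cone is a contracting homotopy for the augmented boundary, on arbitrary chains of
  lists.\<close>

lemma bd_cone: "bd (cone_chain a c) = c - cone_chain a (bd c)"
proof -
  have "bd (cone_chain a c) = lin (\<lambda>v. bd (insertions a v)) c"
    by (simp add: bd_def cone_chain_def lin_lin)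
  also have "\<dots> = c - lin (\<lambda>v. cone_chain a (face v)) c"
    by (simp add: bd_insertions lin_fun_diff lin_id)
  finally show ?thesis by (simp add: bd_def cone_chain_def lin_lin)
qed

lemma cone_prefix_chain:
  "cone_chain a (prefix_chain x c) = prefix_chain a (prefix_chain x c) - prefix_chain x (cone_chain a c)"
proof -
  have "cone_chain a (prefix_chain x c) = lin (\<lambda>v. insertions a (x # v)) c"
    by (simp add: cone_chain_def prefix_chain_def lin_lin)
  then show ?thesis
    by (simp add: lin_fun_diff lin_lin cone_chain_def prefix_chain_def)
qed

lemma cone_single [simp]: "cone_chain a (Poly_Mapping.single w x) = chain_scale x (insertions a w)"
  by (simp add: cone_chain_def)

text \<open>Two insertions in either order give the same lists with opposite signs.\<close>

lemma cone_insertions: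
  "cone_chain a (insertions b w) = - cone_chain b (insertions a w)" "cone_chain a (insertions a w) = 0"
proof -
  show "cone_chain a (insertions b w) = - cone_chain b (insertions a w)" for a b
    by (induction w) (simp_all add: cone_linear cone_prefix_chain prefix_chain_linear)
  \<comment> \<open>This needs its own induction: anticommutation only gives that twice the chain is
    0, which says nothing in characteristic 2.\<close>
  show "cone_chain a (insertions a w) = 0"
    by (induction w) (simp_all add: cone_linear cone_prefix_chain prefix_chain_linear)
qed

lemma cone_anticommute: "cone_chain a (cone_chain b c) = - cone_chain b (cone_chain a c)"
proof -
  have "cone_chain a (cone_chain b c) = lin (\<lambda>v. cone_chain a (insertions b v)) c" for a b
    by (simp add: cone_chain_def lin_lin)
  then show ?thesis
    by (simp add: cone_insertions(1)[of a b] lin_fun_uminus)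
qed

lemma cone_cone: "cone_chain a (cone_chain a c) = 0"
proof -
  have "cone_chain a (cone_chain a c) = lin (\<lambda>v. cone_chain a (insertions a v)) c"
    by (simp add: cone_chain_def lin_lin)
  then show ?thesis
    by (simp add: cone_insertions(2))
qed

lemma bd_chain_map:
  fixes c :: "'v list \<Rightarrow>\<^sub>0 'k::field"
  shows "bd (chain_map f c) = chain_map f (bd c)"
proof -
  have "lin (\<lambda>v. Poly_Mapping.single (map f v) 1) (face v) = (face (map f v) :: _ \<Rightarrow>\<^sub>0 'k)" for v
    by (simp add: face_def map_tl)
  then show ?thesis
    by (simp add: chain_op_defs lin_lin)
qed

lemma chain_map_comp: "chain_map g (chain_map f c) = chain_map (g \<circ> f) c"
  by (simp add: chain_op_defs lin_lin comp_def)

lemma chain_map_cong: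
  "(\<And>v x. v \<in> Poly_Mapping.keys c \<Longrightarrow> x \<in> set v \<Longrightarrow> f x = g x) \<Longrightarrow> chain_map f c = chain_map g c"
  unfolding chain_map_eq_lin by (intro lin_cong arg_cong2[of _ _ _ _ Poly_Mapping.single] map_cong) auto

lemma chain_map_id [simp]: "chain_map (\<lambda>x. x) c = c"
  by (simp add: chain_map_eq_lin lin_id)

lemma link_prefix_chain: "link a (prefix_chain x c) = (if x = a then c else 0)"
  by (simp add: link_def prefix_chain_def lin_lin lin_id)

lemma link_single [simp]:
  "link a (Poly_Mapping.single w x) = (if w \<noteq> [] \<and> hd w = a then Poly_Mapping.single (tl w) x else 0)"
  by (simp add: link_def)

lemma link_insertions:
  "a \<notin> set w \<Longrightarrow> link a (insertions a w) = Poly_Mapping.single w 1"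
  by (induction w) (auto simp: link_linear link_prefix_chain)


section \<open>Oriented simplices span the chains\<close>

text \<open>Closed form of the recursion, in which position \<open>i\<close> carries the sign; it
  can be matched with a sum over permutations.\<close>

lemma insertions_eq_sum:
  "insertions a u =
    (\<Sum>i\<le>length u. Poly_Mapping.single (take i u @ a # drop i u) ((-1) ^ i :: 'k::field))"
proof (induction u)
  case (Cons x u)
  have "prefix_chain x (insertions a u) =
      (\<Sum>i\<le>length u. Poly_Mapping.single (x # take i u @ a # drop i u) ((-1) ^ i :: 'k))"
    by (simp add: Cons.IH prefix_chain_def lin_sum)
  then show ?case
    by (simp del: sum.atMost_Suc add: sum.atMost_Suc_shift single_uminus sum_negf)
qed simp

lemma oriented_simplex_Nil [simp]: "oriented_simplex [] = Poly_Mapping.single [] 1"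
  by (simp add: oriented_simplex_def)

text \<open>Inserting the new vertex at position \<open>i\<close> turns the permutation \<open>q\<close> of \<open>w\<close> into
  the permutation of \<open>a # w\<close> that sends \<open>i\<close> to 0.\<close>

lemma cone_oriented_simplex:
  "cone_chain a (oriented_simplex w :: 'v list \<Rightarrow>\<^sub>0 'k::field) = oriented_simplex (a # w)"
proof -
  let ?n = "length w" and ?j = "\<lambda>p::nat\<Rightarrow>nat. inv_into UNIV p 0"
  have ins: "permute_list (permutation_insert i 0 q) (a # w)
      = take i (permute_list q w) @ a # drop i (permute_list q w)"
    if "i \<le> ?n" "q permutes {0..<?n}" for i q
  proof (rule nth_equalityI)
    show "length (permute_list (permutation_insert i 0 q) (a # w))
      = length (take i (permute_list q w) @ a # drop i (permute_list q w))"
      using that by simp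
    fix k assume "k < length (permute_list (permutation_insert i 0 q) (a # w))"
    then have k: "k < Suc ?n" by simp
    then show "permute_list (permutation_insert i 0 q) (a # w) ! k
      = (take i (permute_list q w) @ a # drop i (permute_list q w)) ! k"
      using that
      by (cases k i rule: linorder_cases)
         (auto simp: permute_list_def permutation_insert_expand nth_append nth_Cons' simp del: upt_Suc)
  qed
  have bij: "bij_betw (\<lambda>(q, i). permutation_insert i 0 q) ({q. q permutes {0..<?n}} \<times> {..?n})
      {p. p permutes {0..<Suc ?n}}"
  \<comment> \<open>The inverse finds the position \<open>?j p\<close> that \<open>p\<close> sends
    to 0 and deletes it.\<close>
  proof (rule bij_betwI[where g = "\<lambda>p. (permutation_delete p (?j p), ?j p)"])
    show "(\<lambda>(q, i). permutation_insert i 0 q) \<in>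
        {q. q permutes {0..<?n}} \<times> {..?n} \<rightarrow> {p. p permutes {0..<Suc ?n}}"
      by (auto intro!: permutation_insert_permutes)
    have inv: "p (?j p) = 0" "?j p < Suc ?n" if "p permutes {0..<Suc ?n}" for p
      using permutes_inverses(1)[OF that] permutes_in_image[OF permutes_inv[OF that], of 0] by auto
    then show "(\<lambda>p. (permutation_delete p (?j p), ?j p)) \<in>
        {p. p permutes {0..<Suc ?n}} \<rightarrow> {q. q permutes {0..<?n}} \<times> {..?n}"
      by (auto simp: less_Suc_eq_le intro!: permutation_delete_permutes)
    show "(\<lambda>(q, i). permutation_insert i 0 q)
        ((\<lambda>p. (permutation_delete p (?j p), ?j p)) p) = p"
      if "p \<in> {p. p permutes {0..<Suc ?n}}" for p
      using that inv[of p] permutation_insert_delete[of p ?n "?j p"] by auto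
    show "(\<lambda>p. (permutation_delete p (?j p), ?j p))
        ((\<lambda>(q, i). permutation_insert i 0 q) x) = x"
      if x: "x \<in> {q. q permutes {0..<?n}} \<times> {..?n}" for x
    proof -
      obtain q i where qi: "x = (q, i)" "q permutes {0..<?n}" "i \<le> ?n" using x by auto
      have "permutation_insert i 0 q permutes {0..<Suc ?n}"
        using qi by (auto intro!: permutation_insert_permutes)
      then have "?j (permutation_insert i 0 q) = i"
        by (metis permutation_insert_inserted permutes_inverses(2))
      then show ?thesis
        by (auto simp: qi permutation_insert_expand permutation_delete_expand)
    qed
  qed
  have sgn: "(of_int (sign (permutation_insert i 0 q)) :: 'k) = (-1) ^ i * of_int (sign q)"
    if "i \<le> ?n" "q permutes {0..<?n}" for i q
    using signof_permutation_insert[OF that(2), of i 0, where 'a='k] that(1) by simp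
  have "cone_chain a (oriented_simplex w :: 'v list \<Rightarrow>\<^sub>0 'k) =
      (\<Sum>q | q permutes {0..<?n}. \<Sum>i\<le>?n.
        Poly_Mapping.single (take i (permute_list q w) @ a # drop i (permute_list q w))
          ((-1) ^ i * of_int (sign q)))"
    by (simp add: oriented_simplex_def cone_chain_def lin_sum insertions_eq_sum chain_scale_sum
        mult.commute)
  also have "\<dots> = (\<Sum>(q, i) \<in> {q. q permutes {0..<?n}} \<times> {..?n}.
      Poly_Mapping.single (permute_list (permutation_insert i 0 q) (a # w))
        (of_int (sign (permutation_insert i 0 q))))"
    unfolding sum.cartesian_product by (intro sum.cong) (auto simp: ins sgn)
  also have "\<dots> = (\<Sum>p | p permutes {0..<Suc ?n}.
      Poly_Mapping.single (permute_list p (a # w)) (of_int (sign p)))"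
    by (rule trans[OF _ sum.reindex_bij_betw[OF bij]]) (auto intro!: sum.cong)
  finally show ?thesis by (simp add: oriented_simplex_def)
qed

text \<open>Each vertex that \<open>x\<close> passes contributes one exchange of two cones, hence
  one sign.\<close>

lemma oriented_simplex_move_front:
  "oriented_simplex (u @ x # v) = chain_scale ((-1) ^ length u) (oriented_simplex (x # u @ v))"
proof (induction u)
  case (Cons y u)
  show ?case
    using Cons by (simp add: cone_linear cone_anticommute[of y x] flip: cone_oriented_simplex)
qed simp

text \<open>A repeated vertex can be moved next to its copy, and a double cone with equal apexes is
  0 in every characteristic.\<close>

lemma oriented_simplex_not_distinct:
  assumes "\<not> distinct v"
  shows "(oriented_simplex v :: 'v list \<Rightarrow>\<^sub>0 'k::field) = 0"
proof -
  have dup: "(oriented_simplex (x # u) :: 'v list \<Rightarrow>\<^sub>0 'k) = 0" if "x \<in> set u" for x u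
  proof -
    from that obtain y z where "u = y @ x # z" by (auto dest: split_list)
    have "cone_chain x (oriented_simplex (x # y @ z) :: 'v list \<Rightarrow>\<^sub>0 'k) = 0"
      by (simp only: cone_cone flip: cone_oriented_simplex)
    then have "cone_chain x (oriented_simplex u :: 'v list \<Rightarrow>\<^sub>0 'k) = 0"
      by (simp only: \<open>u = y @ x # z\<close> oriented_simplex_move_front cone_linear chain_scale_simps)
    then show ?thesis
      by (simp only: cone_oriented_simplex)
  qed
  show ?thesis using assms
  proof (induction v)
    case (Cons x v)
    show ?case
    proof (cases "x \<in> set v")
      case False
      then have "(oriented_simplex v :: 'v list \<Rightarrow>\<^sub>0 'k) = 0" using Cons by simp
      then show ?thesis by (simp add: cone_linear flip: cone_oriented_simplex)
    qed (rule dup)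
  qed simp
qed

section \<open>Chain groups and their generators\<close>

lemma chains_zero: "0 \<in> chains n K"
  by (simp add: chains_def)

lemma chains_add: "b \<in> chains n K \<Longrightarrow> c \<in> chains n K \<Longrightarrow> b + c \<in> chains n K"
  using Poly_Mapping.keys_add[of b c] by (fastforce simp: chains_def lookup_add)

lemma chains_scale: "c \<in> chains n K \<Longrightarrow> chain_scale a c \<in> chains n K"
  by (auto simp: chains_def in_keys_iff)

lemma chains_uminus: "c \<in> chains n K \<Longrightarrow> - c \<in> chains n K"
  using chains_scale[of c n K "-1"] by simp

lemma chains_diff: "b \<in> chains n K \<Longrightarrow> c \<in> chains n K \<Longrightarrow> b - c \<in> chains n K"
  using chains_add[of b n K "- c"] by (simp add: chains_uminus)

text \<open>Repeated vertices are allowed, as the generator is then 0. Images under vertex maps that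
  collapse simplices thus need no extra case.\<close>

lemma oriented_simplex_chain:
  "length v = Suc n \<Longrightarrow> set v \<in> K \<Longrightarrow> oriented_simplex v \<in> chains n K"
  by (cases "distinct v")
     (auto simp: oriented_simplex_in_chains oriented_simplex_not_distinct chains_zero)

lemma lookup_oriented_simplex:
  "Poly_Mapping.lookup (oriented_simplex v :: 'v list \<Rightarrow>\<^sub>0 'k::field) w =
    (\<Sum>p | p permutes {0..<length v}. of_int (sign p) when permute_list p v = w)"
  by (simp add: oriented_simplex_def lookup_sum lookup_single)

lemma keys_oriented_simplex:
  assumes "w \<in> Poly_Mapping.keys (oriented_simplex v :: 'v list \<Rightarrow>\<^sub>0 'k::field)"
  obtains p where "p permutes {..<length v}" "w = permute_list p v"
proof -
  have "\<exists>p. p permutes {0..<length v} \<and> permute_list p v = w"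
  proof (rule ccontr)
    assume "\<not> ?thesis"
    then have "Poly_Mapping.lookup (oriented_simplex v :: 'v list \<Rightarrow>\<^sub>0 'k) w = 0"
      unfolding lookup_oriented_simplex by (intro sum.neutral) auto
    with assms show False by (simp add: in_keys_iff)
  qed
  then show ?thesis using that by (auto simp: atLeast0LessThan)
qed

text \<open>Only the identity fixes a list of distinct vertices. That the coefficient is 1 and not a
  factorial allows generators to be split off over every field.\<close>

lemma lookup_oriented_simplex_self:
  assumes "distinct v"
  shows "Poly_Mapping.lookup (oriented_simplex v :: 'v list \<Rightarrow>\<^sub>0 'k::field) v = 1"
proof -
  have "p = id" if p: "p permutes {0..<length v}" "permute_list p v = v" for p
  proof
    fix i
    show "p i = id i"
    proof (cases "i < length v")
      case True
      then have "v ! (p i) = v ! i" "p i < length v"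
        using p permute_list_nth[of p v i] permutes_in_image[OF p(1), of i]
        by (auto simp: atLeast0LessThan)
      then show ?thesis using True assms by (simp add: nth_eq_iff_index_eq)
    next
      case False
      then show ?thesis using p(1) by (simp add: permutes_not_in)
    qed
  qed
  then have "Poly_Mapping.lookup (oriented_simplex v :: 'v list \<Rightarrow>\<^sub>0 'k) v =
      (\<Sum>p | p permutes {0..<length v}. if p = id then 1 else 0)"
    unfolding lookup_oriented_simplex by (intro sum.cong) (auto simp: when_def)
  then show ?thesis by (simp add: finite_permutations permutes_id)
qed

text \<open>The definition of \<open>chains\<close> covers one exchange of two positions;
  permutations are products of such exchanges.\<close>

lemma lookup_chain_permute_list:
  assumes c: "c \<in> chains n K" and p: "p permutes {..<length v}"
  shows "Poly_Mapping.lookup c (permute_list p v) = of_int (sign p) * Poly_Mapping.lookup c v"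
proof -
  \<comment> \<open>The bound \<open>N\<close> replaces \<open>length v\<close> so that
    \<open>v\<close> can vary in the induction.\<close>
  have "Poly_Mapping.lookup c (permute_list p v) = of_int (sign p) * Poly_Mapping.lookup c v"
    if "p permutes {..<N}" "length v = N" for p v N
    using that(1) finite_lessThan that(2)
  proof (induction p arbitrary: v rule: permutes_induct)
    case (swap i j p)
    let ?t = "Transposition.transpose i j"
    have t: "?t permutes {..<length v}"
      by (rule permutes_swap_id) (use swap in simp_all)
    have "permute_list (Transposition.transpose i j) v = v[i := v ! j, j := v ! i]"
      if "i < j" "j < length v" for i j
      using that by (intro nth_equalityI)
        (auto simp: permute_list_def nth_list_update Transposition.transpose_def)
    then have "Poly_Mapping.lookup c (permute_list (Transposition.transpose i j) v) =
      - Poly_Mapping.lookup c v" if "i < j" "j < length v" for i j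
      using c that by (simp add: chains_def)
    then have l: "Poly_Mapping.lookup c (permute_list ?t v) = - Poly_Mapping.lookup c v"
      using swap.hyps(1-3) swap.prems
      by (metis lessThan_iff linorder_neqE_nat transpose_commute)
    \<comment> \<open>\<open>permute_list\<close> reverses composition, so the induction hypothesis
      is used for the list already transposed.\<close>
    have p: "permute_list (?t \<circ> p) v = permute_list p (permute_list ?t v)"
      using swap.hyps swap.prems by (simp add: permute_list_compose)
    have s: "sign (?t \<circ> p) = - sign p"
      using swap.hyps by (simp add: sign_compose sign_swap_id
          permutes_imp_permutation[of "{..<N}"] permutation_swap_id)
    show ?case
      unfolding p s using l swap.IH[of "permute_list ?t v"] swap.prems by simp
  qed (auto simp: sign_id)
  with p show ?thesis by blast
qed

text \<open>The predicate \<open>Q\<close> selects the orderings of the vertices in which the generators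
  are needed.\<close>

lemma chains_induct [consumes 1, case_names ordering zero add]:
  fixes c :: "'v list \<Rightarrow>\<^sub>0 'k::field"
  assumes "c \<in> chains n K"
    and ordering: "\<And>v. length v = Suc n \<Longrightarrow> distinct v \<Longrightarrow> set v \<in> K \<Longrightarrow>
      \<exists>w. mset w = mset v \<and> Q w"
    and zero: "P 0"
    and add: "\<And>b a v. P b \<Longrightarrow> length v = Suc n \<Longrightarrow> distinct v \<Longrightarrow> set v \<in> K \<Longrightarrow> Q v \<Longrightarrow>
      P (b + chain_scale a (oriented_simplex v))"
  shows "P c"
  using assms(1)
\<comment> \<open>Splitting off a generator removes a list and adds no new one, so the number of
  keys drops.\<close>
proof (induction "card (Poly_Mapping.keys c)" arbitrary: c rule: less_induct)
  case less
  show ?case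
  proof (cases "c = 0")
    case True
    then show ?thesis using zero by simp
  next
    case False
    then obtain v where v: "v \<in> Poly_Mapping.keys c" by fastforce
    then have v': "length v = Suc n" "distinct v" "set v \<in> K" using less.prems by (auto simp: chains_def)
    then obtain w where w: "mset w = mset v" "Q w" using ordering by blast
    have w': "length w = Suc n" "distinct w" "set w \<in> K"
      using v' w(1) mset_eq_length[OF w(1)] mset_eq_setD[OF w(1)] mset_eq_imp_distinct_iff by auto
    obtain p where "p permutes {..<length v}" "permute_list p v = w"
      using mset_eq_permutation[OF w(1)] by blast
    \<comment> \<open>A reordering changes the coefficient only by a sign, so \<open>w\<close>
      occurs in \<open>c\<close> along with \<open>v\<close>.\<close>
    then have wc: "w \<in> Poly_Mapping.keys c"
      using lookup_chain_permute_list[OF less.prems] v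
      by (auto simp: in_keys_iff sign_def split: if_splits)
    define b where "b = c - chain_scale (Poly_Mapping.lookup c w) (oriented_simplex w)"
    have "b \<in> chains n K"
      unfolding b_def using less.prems w'
      by (intro chains_diff chains_scale oriented_simplex_chain) auto
    \<comment> \<open>At \<open>w\<close> the coefficient cancels, and all keys of the generator are
      reorderings of \<open>w\<close>, hence keys of \<open>c\<close>.\<close>
    moreover have "Poly_Mapping.keys b \<subseteq> Poly_Mapping.keys c - {w}"
    proof
      fix u assume u: "u \<in> Poly_Mapping.keys b"
      have "u \<noteq> w" using u w'(2) by (auto simp: b_def in_keys_iff lookup_minus lookup_oriented_simplex_self)
      moreover have "u \<in> Poly_Mapping.keys c"
      proof (rule ccontr)
        assume uc: "u \<notin> Poly_Mapping.keys c"
        then have "u \<in> Poly_Mapping.keys (oriented_simplex w :: 'v list \<Rightarrow>\<^sub>0 'k)"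
          using u by (auto simp: b_def in_keys_iff lookup_minus)
        then obtain p where "p permutes {..<length w}" "u = permute_list p w"
          by (rule keys_oriented_simplex)
        then show False
          using lookup_chain_permute_list[OF less.prems] wc uc
            by (auto simp: in_keys_iff sign_def split: if_splits)
      qed
      ultimately show "u \<in> Poly_Mapping.keys c - {w}" by simp
    qed
    then have "card (Poly_Mapping.keys b) < card (Poly_Mapping.keys c)"
      using wc by (intro psubset_card_mono) auto
    ultimately have "P b" using less.hyps by blast
    then have "P (b + chain_scale (Poly_Mapping.lookup c w) (oriented_simplex w))"
      using add w w' by blast
    then show ?thesis by (simp add: b_def)
  qed
qed

lemma chains_span_induct [consumes 1, case_names zero add]:
  assumes "c \<in> chains n K" and "P 0"
    and "\<And>b a v. P b \<Longrightarrow> length v = Suc n \<Longrightarrow> distinct v \<Longrightarrow> set v \<in> K \<Longrightarrow>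
      P (b + chain_scale a (oriented_simplex v))"
  shows "P c"
  using assms(1) by (induction rule: chains_induct[where Q = "\<lambda>_. True"]) (auto intro: assms)


section \<open>Boundaries, chain maps and contiguity\<close>

definition simplicial_complex :: "'v set set \<Rightarrow> bool" where
  "simplicial_complex K \<longleftrightarrow>
    (\<forall>\<sigma>\<in>K. \<sigma> \<noteq> {} \<and> (\<forall>\<tau>. \<tau> \<subseteq> \<sigma> \<and> \<tau> \<noteq> {} \<longrightarrow> \<tau> \<in> K))"

definition simplicial :: "'v set set \<Rightarrow> 'w set set \<Rightarrow> ('v \<Rightarrow> 'w) \<Rightarrow> bool" where
  "simplicial K L f \<longleftrightarrow> (\<forall>\<sigma>\<in>K. f ` \<sigma> \<in> L)"

definition contiguous :: "'v set set \<Rightarrow> 'w set set \<Rightarrow> ('v \<Rightarrow> 'w) \<Rightarrow> ('v \<Rightarrow> 'w) \<Rightarrow> bool" where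
  "contiguous K L f g \<longleftrightarrow> (\<forall>\<sigma>\<in>K. f ` \<sigma> \<union> g ` \<sigma> \<in> L)"

text \<open>Positive degree is essential: in degree 0 \<open>boundary\<close> is 0 but
  \<open>bd\<close> is the augmentation.\<close>

lemma boundary_eq_bd:
  assumes "c \<in> chains n K" "n > 0"
  shows "boundary n c = bd c"
proof -
  have "v \<noteq> []" if "v \<in> Poly_Mapping.keys c" for v
    using that assms by (auto simp: chains_def)
  then show ?thesis using assms(2)
    by (auto simp: boundary_def bd_def lin_def face_def intro!: sum.cong)
qed

lemma chain_map_chains:
  fixes c :: "'v list \<Rightarrow>\<^sub>0 'k::field"
  assumes "c \<in> chains n K" "simplicial K L f"
  shows "chain_map f c \<in> chains n L"
  using assms(1)
proof (induction rule: chains_span_induct)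
  case (add b a v)
  have "(oriented_simplex (map f v) :: _ \<Rightarrow>\<^sub>0 'k) \<in> chains n L"
    using add assms(2) by (intro oriented_simplex_chain) (auto simp: simplicial_def)
  then show ?case
    using add by (simp add: chain_map_linear chain_map_oriented_simplex chains_add chains_scale)
qed (simp add: chain_map_linear chains_zero)

section \<open>Links and the effect of moving one vertex\<close>

lemma keys_lin: "Poly_Mapping.keys (lin f c) \<subseteq> (\<Union>v\<in>Poly_Mapping.keys c. Poly_Mapping.keys (f v))"
proof
  fix w assume "w \<in> Poly_Mapping.keys (lin f c)"
  then have "(\<Sum>v\<in>Poly_Mapping.keys c. Poly_Mapping.lookup c v * Poly_Mapping.lookup (f v) w) \<noteq> 0"
    by (simp add: lin_def in_keys_iff lookup_sum)
  then obtain v where "v \<in> Poly_Mapping.keys c" "Poly_Mapping.lookup (f v) w \<noteq> 0"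
    by (metis (no_types, lifting) mult_zero_right sum.neutral)
  then show "w \<in> (\<Union>v\<in>Poly_Mapping.keys c. Poly_Mapping.keys (f v))"
    by (auto simp: in_keys_iff)
qed

text \<open>No such list starts with \<open>a\<close>, and among the insertions of \<open>a\<close>
  into it only the one at the front does.\<close>

lemma link_avoiding:
  assumes "\<And>v. v \<in> Poly_Mapping.keys c \<Longrightarrow> a \<notin> set v"
  shows "link a c = 0" "link a (cone_chain a c) = c"
proof -
  have "link a c = lin (\<lambda>v. 0) c"
    unfolding link_def using assms by (intro lin_cong) (metis hd_in_set)
  then show "link a c = 0" by simp
  have "link a (cone_chain a c) = lin (\<lambda>v. link a (insertions a v)) c"
    by (simp add: link_def cone_chain_def lin_lin)
  also have "\<dots> = lin (\<lambda>v. Poly_Mapping.single v 1) c"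
    using assms by (intro lin_cong) (auto simp: link_insertions)
  finally show "link a (cone_chain a c) = c" by (simp add: lin_id)
qed

lemma oriented_simplex_avoiding:
  assumes "a \<notin> set w"
  shows "v \<in> Poly_Mapping.keys (oriented_simplex w :: 'v list \<Rightarrow>\<^sub>0 'k::field) \<Longrightarrow> a \<notin> set v"
    and "v \<in> Poly_Mapping.keys (bd (oriented_simplex w) :: 'v list \<Rightarrow>\<^sub>0 'k) \<Longrightarrow> a \<notin> set v"
proof -
  show *: "a \<notin> set v" if "v \<in> Poly_Mapping.keys (oriented_simplex w :: 'v list \<Rightarrow>\<^sub>0 'k)" for v
    using that assms by (auto elim!: keys_oriented_simplex)
  show "a \<notin> set v" if "v \<in> Poly_Mapping.keys (bd (oriented_simplex w) :: 'v list \<Rightarrow>\<^sub>0 'k)"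
  proof -
    from that obtain u where "u \<in> Poly_Mapping.keys (oriented_simplex w :: 'v list \<Rightarrow>\<^sub>0 'k)"
        "v \<in> Poly_Mapping.keys (face u :: 'v list \<Rightarrow>\<^sub>0 'k)"
      using keys_lin[of face "oriented_simplex w :: 'v list \<Rightarrow>\<^sub>0 'k"] unfolding bd_def by blast
    then show ?thesis using *[of u]
      by (auto simp: face_def split: if_splits dest: list.set_sel(2))
  qed
qed

text \<open>Generators avoiding \<open>a\<close> and generators with \<open>a\<close> in front
  suffice, because \<open>a\<close> can be moved to the front up to sign; on both kinds the link is
  known explicitly.\<close>

lemma vertex_first_induct [consumes 1, case_names zero avoid first]:
  fixes c :: "'v list \<Rightarrow>\<^sub>0 'k::field"
  assumes "c \<in> chains n K" and "P 0"
    and "\<And>b x v. P b \<Longrightarrow> length v = Suc n \<Longrightarrow> set v \<in> K \<Longrightarrow> a \<notin> set v \<Longrightarrow>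
      P (b + chain_scale x (oriented_simplex v))"
    and "\<And>b x w. P b \<Longrightarrow> length w = n \<Longrightarrow> insert a (set w) \<in> K \<Longrightarrow> a \<notin> set w \<Longrightarrow>
      P (b + chain_scale x (oriented_simplex (a # w)))"
  shows "P c"
  using assms(1)
proof (induction rule: chains_induct[where Q = "\<lambda>v. a \<notin> set v \<or> hd v = a"])
  case (ordering v)
  show ?case
  proof (cases "a \<in> set v")
    case True
    then obtain y z where "v = y @ a # z" by (meson split_list)
    then show ?thesis by (intro exI[of _ "a # y @ z"]) auto
  qed auto
next
  case (add b x v)
  show ?case
  proof (cases "a \<in> set v")
    case True
    then have "v = a # tl v" using add by (cases v) auto
    then show ?thesis using add assms(4)[of b "tl v" x]
      by (metis Suc_inject distinct.simps(2) length_Cons list.simps(15))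
  qed (use add assms(3) in auto)
qed (rule assms(2))

lemma link_oriented_simplex:
  shows "a \<notin> set v \<Longrightarrow> link a (oriented_simplex v :: 'v list \<Rightarrow>\<^sub>0 'k::field) = 0"
    and "a \<notin> set v \<Longrightarrow> link a (oriented_simplex (a # v) :: 'v list \<Rightarrow>\<^sub>0 'k) = oriented_simplex v"
  unfolding cone_oriented_simplex[symmetric]
  by (rule link_avoiding; erule (1) oriented_simplex_avoiding)+

text \<open>In the boundary of \<open>a # w\<close> only the cone over the boundary of
  \<open>w\<close> contains \<open>a\<close>, and it enters with a minus sign. Chains with zero
  \<open>bd\<close> thus have links with zero \<open>bd\<close>.\<close>

lemma bd_link:
  fixes c :: "'v list \<Rightarrow>\<^sub>0 'k::field"
  assumes "c \<in> chains n K"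
  shows "bd (link a c) = - link a (bd c)"
  using assms
proof (induction rule: vertex_first_induct[where a = a])
  case (avoid b x v)
  have "link a (bd (oriented_simplex v) :: 'v list \<Rightarrow>\<^sub>0 'k) = 0"
    by (rule link_avoiding; erule oriented_simplex_avoiding(2)[OF avoid(4)])
  then show ?case
    by (simp add: avoid.IH bd_linear link_linear link_oriented_simplex avoid.hyps)
next
  case (first b x w)
  have "link a (cone_chain a (bd (oriented_simplex w) :: 'v list \<Rightarrow>\<^sub>0 'k)) = bd (oriented_simplex w)"
    by (rule link_avoiding; erule oriented_simplex_avoiding(2)[OF first(4)])
  then have "link a (bd (oriented_simplex (a # w) :: 'v list \<Rightarrow>\<^sub>0 'k)) = - bd (oriented_simplex w)"
    by (simp add: bd_cone link_linear link_oriented_simplex first.hyps flip: cone_oriented_simplex)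
  then show ?case
    by (simp add: first.IH bd_linear link_linear link_oriented_simplex first.hyps)
qed (simp add: bd_linear link_linear)

text \<open>Simplices without \<open>a\<close> have equal images; a simplex \<open>a # w\<close>
  goes to two cones over the same image of \<open>w\<close>.\<close>

lemma chain_map_change_vertex:
  assumes "c \<in> chains n K" and eq: "\<And>x. x \<noteq> a \<Longrightarrow> f' x = f x"
  shows "chain_map f' c - chain_map f c =
    cone_chain (f' a) (chain_map f (link a c)) - cone_chain (f a) (chain_map f (link a c))"
  using assms(1)
proof (induction rule: vertex_first_induct[where a = a])
  case (avoid b x v)
  then have "map f' v = map f v" by (intro map_cong refl eq) auto
  then show ?case using avoid
    by (simp del: map_eq_conv add: chain_map_linear link_linear cone_linear link_oriented_simplex
        chain_map_oriented_simplex)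
next
  case (first b x w)
  then have "map f' w = map f w" by (intro map_cong refl eq) auto
  then show ?case using first
    by (simp del: map_eq_conv add: chain_map_linear link_linear cone_linear link_oriented_simplex
        chain_map_oriented_simplex cone_oriented_simplex add_diff_add)
qed (simp add: chain_map_linear link_linear cone_linear)

section \<open>Cycles, boundaries and homologous images\<close>

lemma boundaries_eq: "boundaries n K = bd ` chains (Suc n) K"
  unfolding boundaries_def by (intro image_cong) (auto simp: boundary_eq_bd)

lemma cycle_iff: "c \<in> carrier (cycles n K) \<longleftrightarrow> c \<in> chains n K \<and> (n = 0 \<or> bd c = 0)"
proof (cases "n = 0")
  case False
  then show ?thesis
    using boundary_eq_bd[of c n K] by (auto simp: cycles_def)
qed (auto simp: cycles_def boundary_def)

lemma boundary_mem: "c \<in> chains (Suc n) K \<Longrightarrow> bd c \<in> boundaries n K"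
  by (simp add: boundaries_eq)

lemma boundariesE:
  assumes "b \<in> boundaries n K"
  obtains c where "c \<in> chains (Suc n) K" "b = bd c"
  using assms by (auto simp: boundaries_eq)

lemma homologous_change_vertex:
  fixes c :: "'v list \<Rightarrow>\<^sub>0 'k::field"
  assumes c: "c \<in> carrier (cycles n K)"
    and eq: "\<And>x. x \<noteq> a \<Longrightarrow> f' x = f x" and contig: "contiguous K L f f'"
  shows "chain_map f' c - chain_map f c \<in> boundaries n L"
proof -
  let ?e = "chain_map f (link a c)"
  let ?h = "\<lambda>c. cone_chain (f a) (cone_chain (f' a) (chain_map f (link a c)))"
  have cc: "c \<in> chains n K" using c by (simp add: cycle_iff)
  \<comment> \<open>In degree 0, \<open>bd c\<close> is a multiple of the empty list, in which
    \<open>a\<close> cannot occur.\<close>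
  have "link a (bd c) = 0"
  proof (cases "n = 0")
    case True
    from cc[unfolded True] show ?thesis
    proof (induction rule: chains_span_induct)
      case (add b x v)
      then obtain y where "v = [y]" by (metis One_nat_def length_0_conv length_Suc_conv)
      then show ?case using add
        by (simp add: bd_linear link_linear bd_cone flip: cone_oriented_simplex)
           (simp add: bd_def face_def)
    qed (simp add: bd_linear link_linear)
  qed (use c in \<open>simp add: cycle_iff link_linear\<close>)
  then have "bd ?e = 0"
    by (simp add: bd_chain_map bd_link[OF cc] chain_map_linear)
  \<comment> \<open>Applying \<open>bd_cone\<close> twice leaves the two single cones over
    \<open>?e\<close>, with opposite signs, and a term with \<open>bd ?e\<close>.\<close>
  then have "bd (?h c) = chain_map f' c - chain_map f c"
    by (simp add: bd_cone cone_linear chain_map_change_vertex[OF cc eq])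
  moreover have "?h c \<in> chains (Suc n) L"
    using cc
  proof (induction rule: vertex_first_induct[where a = a])
    case (first b x w)
    have "f' ` set w = f ` set w" using first by (intro image_cong refl eq) auto
    \<comment> \<open>Away from \<open>a\<close> the maps agree, so the vertices of the double cone
      are those of the union that contiguity puts into \<open>L\<close>.\<close>
    moreover have "f ` insert a (set w) \<union> f' ` insert a (set w) \<in> L"
      using first contig by (simp only: contiguous_def)
    ultimately have "set (f a # f' a # map f w) \<in> L"
      by (simp add: insert_commute Un_insert_right Un_insert_left del: insert_iff)
    then have "(oriented_simplex (f a # f' a # map f w) :: _ \<Rightarrow>\<^sub>0 'k) \<in> chains (Suc n) L"
      using first by (intro oriented_simplex_chain) auto
    then show ?case using first
      by (simp add: link_linear chain_map_linear cone_linear link_oriented_simplex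
        chain_map_oriented_simplex cone_oriented_simplex chains_add chains_scale)
  qed (simp_all add: link_linear chain_map_linear cone_linear chains_zero link_oriented_simplex)
  ultimately show ?thesis
    using boundary_mem by metis
qed

lemma boundaries_add:
  assumes "b \<in> boundaries n K" "c \<in> boundaries n K"
  shows "b + c \<in> boundaries n K"
proof -
  obtain b' c' where "b' \<in> chains (Suc n) K" "b = bd b'" "c' \<in> chains (Suc n) K" "c = bd c'"
    using assms by (elim boundariesE)
  then show ?thesis
    by (metis bd_linear(1) boundary_mem chains_add)
qed

lemma boundaries_scale:
  assumes "c \<in> boundaries n K"
  shows "chain_scale a c \<in> boundaries n K"
proof -
  obtain b where "b \<in> chains (Suc n) K" "c = bd b"
    using assms by (elim boundariesE)
  then show ?thesis
    by (metis bd_linear(5) boundary_mem chains_scale)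
qed

lemma boundaries_zero: "0 \<in> boundaries n K"
  using boundary_mem[OF chains_zero, of n K] by (simp add: bd_linear)

lemma chain_map_boundaries:
  assumes "c \<in> boundaries n K" "simplicial K L f"
  shows "chain_map f c \<in> boundaries n L"
proof -
  obtain b where "b \<in> chains (Suc n) K" "c = bd b"
    using assms by (elim boundariesE)
  then show ?thesis
    using boundary_mem[OF chain_map_chains[OF _ assms(2)]] by (simp add: bd_chain_map)
qed

lemma chain_map_cycles:
  "c \<in> carrier (cycles n K) \<Longrightarrow> simplicial K L f \<Longrightarrow> chain_map f c \<in> carrier (cycles n L)"
  by (auto simp: cycle_iff bd_chain_map chain_map_linear intro: chain_map_chains)

text \<open>The vertices that occur in \<open>c\<close> are moved from \<open>f\<close> to \<open>g\<close> one at a time.\<close>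

lemma contiguous_homologous:
  assumes c: "c \<in> carrier (cycles n K)"
    and contig: "contiguous K L f g" and L: "simplicial_complex L"
  shows "chain_map g c - chain_map f c \<in> boundaries n L"
proof -
  define V where "V = (\<Union>v\<in>Poly_Mapping.keys c. set v)"
  define m where "m = (\<lambda>S x. if x \<in> S then g x else f x)"
  have "finite V" by (simp add: V_def)
  then have "chain_map (m V) c - chain_map f c \<in> boundaries n L"
  proof induction
    case empty
    have "m {} = f" by (simp add: m_def)
    then show ?case by (simp add: boundaries_zero)
  next
    case (insert a S)
    have "contiguous K L (m S) (m (insert a S))"
      unfolding contiguous_def
    proof
      fix \<sigma> assume \<sigma>: "\<sigma> \<in> K"
      show "m S ` \<sigma> \<union> m (insert a S) ` \<sigma> \<in> L"
      \<comment> \<open>The empty set may lie in \<open>K\<close>; it is not covered by closure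
        under nonempty faces.\<close>
      proof (cases "\<sigma> = {}")
        case True
        then show ?thesis using \<sigma> contig by (auto simp: contiguous_def)
      next
        case False
        \<comment> \<open>Every intermediate vertex is a value of \<open>f\<close> or
          \<open>g\<close>, so the image is a face of the simplex given by contiguity.\<close>
        have "m S ` \<sigma> \<union> m (insert a S) ` \<sigma> \<subseteq> f ` \<sigma> \<union> g ` \<sigma>" by (auto simp: m_def)
        then show ?thesis
          using \<sigma> False contig L unfolding contiguous_def simplicial_complex_def by blast
      qed
    qed
    then have "chain_map (m (insert a S)) c - chain_map (m S) c \<in> boundaries n L"
      by (intro homologous_change_vertex[OF c]) (auto simp: m_def)
    from boundaries_add[OF this insert.IH] show ?case by simp
  qed
  \<comment> \<open>\<open>V\<close> contains all vertices of \<open>c\<close>, and there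
    \<open>m V\<close> agrees with \<open>g\<close>.\<close>
  moreover have "chain_map (m V) c = chain_map g c"
    by (intro chain_map_cong) (auto simp: m_def V_def)
  ultimately show ?thesis by simp
qed


section \<open>Homology classes\<close>

definition hclass :: "nat \<Rightarrow> 'v set set \<Rightarrow> ('v list \<Rightarrow>\<^sub>0 'k::field) \<Rightarrow> ('v list \<Rightarrow>\<^sub>0 'k) set" where
  "hclass n K c = boundaries n K +>\<^bsub>cycles n K\<^esub> c"

lemma cycles_add:
  "b \<in> carrier (cycles n K) \<Longrightarrow> c \<in> carrier (cycles n K) \<Longrightarrow> b + c \<in> carrier (cycles n K)"
  by (auto simp: cycle_iff chains_add bd_linear)

lemma cycles_scale: "c \<in> carrier (cycles n K) \<Longrightarrow> chain_scale a c \<in> carrier (cycles n K)"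
  by (auto simp: cycle_iff chains_scale bd_linear)

lemma cycles_zero: "0 \<in> carrier (cycles n K)"
  by (auto simp: cycle_iff chains_zero bd_linear)

lemma boundaries_uminus: "c \<in> boundaries n K \<Longrightarrow> - c \<in> boundaries n K"
  using boundaries_scale[of c n K "-1"] by simp

lemma boundaries_diff:
  "b \<in> boundaries n K \<Longrightarrow> c \<in> boundaries n K \<Longrightarrow> b - c \<in> boundaries n K"
  using boundaries_add[of b n K "- c"] by (simp add: boundaries_uminus)

lemma mem_hclass_iff: "b \<in> hclass n K c \<longleftrightarrow> b - c \<in> boundaries n K"
proof -
  have "hclass n K c = (\<lambda>h. h + c) ` boundaries n K"
    by (auto simp: hclass_def a_r_coset_defs cycles_def)
  also have "b \<in> \<dots> \<longleftrightarrow> b - c \<in> boundaries n K"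
    by (auto simp: image_iff) (metis diff_add_cancel)
  finally show ?thesis .
qed

lemma hclass_self: "c \<in> hclass n K c"
  by (simp add: mem_hclass_iff boundaries_zero)

lemma hclass_nonempty: "hclass n K c \<noteq> {}"
  using hclass_self by blast

lemma hclass_eq_iff: "hclass n K b = hclass n K c \<longleftrightarrow> b - c \<in> boundaries n K"
proof
  assume "hclass n K b = hclass n K c"
  then show "b - c \<in> boundaries n K" using hclass_self mem_hclass_iff by blast
next
  assume bc: "b - c \<in> boundaries n K"
  have "x - b \<in> boundaries n K \<longleftrightarrow> x - c \<in> boundaries n K" for x
    using boundaries_add[OF _ bc, of "x - b"] boundaries_diff[OF _ bc, of "x - c"] by auto
  then show "hclass n K b = hclass n K c"
    by (auto simp: mem_hclass_iff)
qed

lemma carrier_homology: "carrier (homology n K) = hclass n K ` carrier (cycles n K)"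
  by (auto simp: homology_def quotient_space_def A_RCOSETS_def' hclass_def)

lemma zero_homology: "zero (homology n K) = hclass n K 0"
  by (auto simp: homology_def quotient_space_def mem_hclass_iff)

lemma add_homology:
  "add (homology n K) (hclass n K b) (hclass n K c) = hclass n K (b + c)"
proof -
  have "add (homology n K) (hclass n K b) (hclass n K c) =
      {x + y |x y. x \<in> hclass n K b \<and> y \<in> hclass n K c}"
    by (auto simp: homology_def quotient_space_def set_add_def set_mult_def cycles_def)
  also have "\<dots> = hclass n K (b + c)"
  proof (intro equalityI subsetI)
    fix z assume "z \<in> {x + y |x y. x \<in> hclass n K b \<and> y \<in> hclass n K c}"
    then obtain x y where "z = x + y" "x - b \<in> boundaries n K" "y - c \<in> boundaries n K"
      by (auto simp: mem_hclass_iff)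
    then show "z \<in> hclass n K (b + c)"
      using boundaries_add[of "x - b" n K "y - c"] by (simp add: mem_hclass_iff algebra_simps)
  next
    fix z assume "z \<in> hclass n K (b + c)"
    then have "z - c \<in> hclass n K b" by (simp add: mem_hclass_iff algebra_simps)
    then show "z \<in> {x + y |x y. x \<in> hclass n K b \<and> y \<in> hclass n K c}"
      using hclass_self[of c n K] by (intro CollectI exI[of _ "z - c"] exI[of _ c]) simp
  qed
  finally show ?thesis .
qed

text \<open>The union in \<open>quotient_space\<close> runs over representatives whose scaled cosets
  all coincide, since boundaries are closed under scaling.\<close>

lemma smult_homology: "smult (homology n K) a (hclass n K c) = hclass n K (chain_scale a c)"
proof -
  have "smult (homology n K) a (hclass n K c) = (\<Union>x\<in>hclass n K c. hclass n K (chain_scale a x))"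
    by (simp add: homology_def quotient_space_def hclass_def) (simp add: cycles_def)
  also have "\<dots> = hclass n K (chain_scale a c)"
  proof -
    have *: "hclass n K (chain_scale a x) = hclass n K (chain_scale a c)" if "x \<in> hclass n K c" for x
      using that boundaries_scale[of "x - c" n K a]
      by (simp add: mem_hclass_iff hclass_eq_iff chain_scale_diff_right)
    show ?thesis by (rule SUP_eq_const[OF hclass_nonempty *])
  qed
  finally show ?thesis .
qed

lemmas homology_ops = carrier_homology zero_homology add_homology smult_homology

lemma vectorspace_homology:
  "vectorspace class_ring (homology n K :: ('k::field, ('v list \<Rightarrow>\<^sub>0 'k) set) module)"
proof -
  let ?H = "homology n K :: ('k, ('v list \<Rightarrow>\<^sub>0 'k) set) module"
  have field: "field (class_ring :: 'k ring)" by (rule class_field)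
  then have "cring (class_ring :: 'k ring)" by (simp add: field_def domain_def)
  moreover have "abelian_group ?H"
  proof (rule abelian_groupI)
    fix x assume "x \<in> carrier ?H"
    then obtain c where c: "c \<in> carrier (cycles n K)" "x = hclass n K c"
      by (auto simp: carrier_homology)
    show "\<exists>y\<in>carrier ?H. y \<oplus>\<^bsub>?H\<^esub> x = \<zero>\<^bsub>?H\<^esub>"
      using c cycles_scale[of c n K "-1"]
      by (intro bexI[of _ "hclass n K (- c)"]) (auto simp: homology_ops)
  qed (auto simp: homology_ops cycles_zero intro!: cycles_add imageI simp: algebra_simps)
  ultimately have "module class_ring ?H"
    by (rule moduleI)
       (auto simp: homology_ops chain_scale_add_left chain_scale_add_right intro: cycles_scale)
  then show ?thesis
    using field by (simp add: vectorspace_def)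
qed

text \<open>Chain maps preserve boundaries, so all representatives yield one coset; the union over
  the nonempty class is that coset.\<close>

lemma homology_map_hclass:
  assumes "simplicial K L f"
  shows "homology_map n L f (hclass n K c) = hclass n L (chain_map f c)"
proof -
  have *: "hclass n L (chain_map f x) = hclass n L (chain_map f c)" if "x \<in> hclass n K c" for x
    using that chain_map_boundaries[OF _ assms, of "x - c" n]
    by (simp add: mem_hclass_iff hclass_eq_iff chain_map_linear)
  have "(\<Union>x\<in>hclass n K c. hclass n L (chain_map f x)) = hclass n L (chain_map f c)"
    by (rule SUP_eq_const[OF hclass_nonempty *])
  then show ?thesis
    by (simp add: homology_map_def hclass_def)
qed

lemma linear_homology_map:
  fixes f :: "'v \<Rightarrow> 'w"
  assumes "simplicial K L f"
  shows "linear_map class_ring (homology n K :: ('k::field, ('v list \<Rightarrow>\<^sub>0 'k) set) module)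
    (homology n L) (homology_map n L f)"
proof -
  have "homology_map n L f \<in> module_hom class_ring
      (homology n K :: ('k, ('v list \<Rightarrow>\<^sub>0 'k) set) module) (homology n L)"
    using assms
    by (auto simp: module_hom_def homology_ops homology_map_hclass chain_map_linear
        intro: chain_map_cycles)
  moreover have "vectorspace class_ring (homology n K :: ('k, ('v list \<Rightarrow>\<^sub>0 'k) set) module)"
      "vectorspace class_ring (homology n L :: ('k, ('w list \<Rightarrow>\<^sub>0 'k) set) module)"
    by (rule vectorspace_homology)+
  ultimately show ?thesis
    by (simp add: linear_map_def mod_hom_def mod_hom_axioms_def vectorspace_def)
qed

lemma homology_map_comp:
  assumes "simplicial K L f" "simplicial L M g" "x \<in> carrier (homology n K)"
  shows "homology_map n M g (homology_map n L f x) = homology_map n M (g \<circ> f) x"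
proof -
  have "simplicial K M (g \<circ> f)" using assms by (simp add: simplicial_def flip: image_image)
  then show ?thesis
    using assms by (auto simp: carrier_homology homology_map_hclass chain_map_comp)
qed

lemma homology_map_ident: "x \<in> carrier (homology n K) \<Longrightarrow> homology_map n K (\<lambda>x. x) x = x"
  by (auto simp: carrier_homology homology_map_hclass[of K] simplicial_def)

section \<open>Contiguous maps on homology\<close>

lemma contiguous_sym: "contiguous K L f g \<Longrightarrow> contiguous K L g f"
  by (simp add: contiguous_def Un_commute)

lemma contiguous_simplicial:
  assumes "simplicial_complex K" "simplicial_complex L" "contiguous K L f g"
  shows "simplicial K L f"
  unfolding simplicial_def
proof
  fix \<sigma> assume "\<sigma> \<in> K"
  then have "\<sigma> \<noteq> {}" and L: "f ` \<sigma> \<union> g ` \<sigma> \<in> L"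
    using assms(1,3) unfolding simplicial_complex_def contiguous_def by blast+
  then have "f ` \<sigma> \<noteq> {}" by simp
  then show "f ` \<sigma> \<in> L"
    using assms(2) L Un_upper1[of "f ` \<sigma>" "g ` \<sigma>"] unfolding simplicial_complex_def by blast
qed

text \<open>Strict commutation as a case of contiguity. Agreement on vertices of \<open>K\<close>
  suffices, which matters because vertex maps are arbitrary elsewhere.\<close>

lemma contiguous_if_eq:
  assumes "simplicial K L f" "\<And>\<sigma> x. \<sigma> \<in> K \<Longrightarrow> x \<in> \<sigma> \<Longrightarrow> f x = g x"
  shows "contiguous K L f g"
  unfolding contiguous_def
proof
  fix \<sigma> assume \<sigma>: "\<sigma> \<in> K"
  then have "g ` \<sigma> = f ` \<sigma>" using assms(2) by (intro image_cong) auto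
  then show "f ` \<sigma> \<union> g ` \<sigma> \<in> L" using assms(1) \<sigma> by (simp add: simplicial_def)
qed

lemma contiguous_homology_map:
  assumes "simplicial_complex K" "simplicial_complex L" "contiguous K L f g"
    and "x \<in> carrier (homology n K)"
  shows "homology_map n L f x = homology_map n L g x"
proof -
  have "simplicial K L f" "simplicial K L g"
    using assms contiguous_simplicial contiguous_sym by blast+
  moreover obtain c where "c \<in> carrier (cycles n K)" "x = hclass n K c"
    using assms(4) by (auto simp: carrier_homology)
  moreover from this have "chain_map f c - chain_map g c \<in> boundaries n L"
    using contiguous_homologous contiguous_sym assms(2,3) by blast
  ultimately show ?thesis
    by (simp add: homology_map_hclass hclass_eq_iff)
qed

section \<open>Diagrams that commute up to contiguity\<close>

text \<open>Identity and composition laws are imposed up to contiguity: this is enough for homology,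
  and equations of vertex maps can fail outside the vertices of the complexes.\<close>

definition complex_diagram :: "(real \<Rightarrow> 'v set set) \<Rightarrow> (real \<Rightarrow> real \<Rightarrow> 'v \<Rightarrow> 'v) \<Rightarrow> bool" where
  "complex_diagram K f \<longleftrightarrow>
     (\<forall>r\<ge>0. simplicial_complex (K r) \<and> contiguous (K r) (K r) (f r r) (\<lambda>x. x)) \<and>
     (\<forall>r s. 0 \<le> r \<and> r \<le> s \<longrightarrow> simplicial (K r) (K s) (f r s)) \<and>
     (\<forall>r s t. 0 \<le> r \<and> r \<le> s \<and> s \<le> t \<longrightarrow> contiguous (K r) (K t) (f s t \<circ> f r s) (f r t))"

lemma persistence_module_persistent_homology:
  fixes K :: "real \<Rightarrow> 'v set set"
  assumes "complex_diagram K f"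
  shows "persistence_module (persistent_homology n K f :: ('k::field, ('v list \<Rightarrow>\<^sub>0 'k) set) pmodule)"
proof -
  have cx: "simplicial_complex (K r)" "contiguous (K r) (K r) (f r r) (\<lambda>x. x)" if "0 \<le> r" for r
    using assms that by (auto simp: complex_diagram_def)
  have maps: "simplicial (K r) (K s) (f r s)" if "0 \<le> r" "r \<le> s" for r s
    using assms that by (auto simp: complex_diagram_def)
  have comp: "contiguous (K r) (K t) (f s t \<circ> f r s) (f r t)" if "0 \<le> r" "r \<le> s" "s \<le> t" for r s t
    using assms that by (auto simp: complex_diagram_def)
  have "homology_map n (K t) (f s t) (homology_map n (K s) (f r s) x) = homology_map n (K t) (f r t) x"
    if "0 \<le> r" "r \<le> s" "s \<le> t" "x \<in> carrier (homology n (K r))"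
    for r s t and x :: "('v list \<Rightarrow>\<^sub>0 'k) set"
  proof -
    have "homology_map n (K t) (f s t) (homology_map n (K s) (f r s) x) =
        homology_map n (K t) (f s t \<circ> f r s) x"
      using that by (intro homology_map_comp[OF maps maps]) auto
    also have "\<dots> = homology_map n (K t) (f r t) x"
      using that by (intro contiguous_homology_map[OF cx(1) cx(1) comp]) auto
    finally show ?thesis .
  qed
  moreover have "homology_map n (K r) (f r r) x = x"
    if "0 \<le> r" "x \<in> carrier (homology n (K r))" for r and x :: "('v list \<Rightarrow>\<^sub>0 'k) set"
    using contiguous_homology_map[OF cx(1) cx(1) cx(2), of r x n] homology_map_ident that by simp
  ultimately show ?thesis
    by (simp add: persistence_module_def persistent_homology_def vectorspace_homology
        linear_homology_map maps)
qed

text \<open>Both ways around a square are induced by composites of vertex maps, and contiguous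
  composites agree on homology.\<close>

lemma nat_trans_persistent_homology:
  fixes K :: "real \<Rightarrow> 'v set set" and L :: "real \<Rightarrow> 'w set set"
  assumes K: "complex_diagram K f" and L: "complex_diagram L g" and c: "c \<ge> 1"
    and p: "\<And>r. 0 \<le> r \<Longrightarrow> simplicial (K r) (L (c * r)) (p r)"
    and nat: "\<And>r s. 0 \<le> r \<Longrightarrow> r \<le> s \<Longrightarrow>
      contiguous (K r) (L (c * s)) (p s \<circ> f r s) (g (c * r) (c * s) \<circ> p r)"
  shows "nat_trans (persistent_homology n K f :: ('k::field, ('v list \<Rightarrow>\<^sub>0 'k) set) pmodule)
    (rescale c (persistent_homology n L g))
    (\<lambda>r. homology_map n (L (c * r)) (p r))"
proof -
  have "homology_map n (L (c * s)) (p s) (homology_map n (K s) (f r s) x) =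
      homology_map n (L (c * s)) (g (c * r) (c * s)) (homology_map n (L (c * r)) (p r) x)"
    if "0 \<le> r" "r \<le> s" "x \<in> carrier (homology n (K r))" for r s and x :: "('v list \<Rightarrow>\<^sub>0 'k) set"
  proof -
    have "0 \<le> s" "0 \<le> c * r" "c * r \<le> c * s" using that c by auto
    then have maps: "simplicial (K r) (K s) (f r s)" "simplicial (L (c * r)) (L (c * s)) (g (c * r) (c * s))"
      and cx: "simplicial_complex (K r)" "simplicial_complex (L (c * s))"
      using K L that c by (auto simp: complex_diagram_def)
    show ?thesis
      using homology_map_comp[OF maps(1) p[OF \<open>0 \<le> s\<close>] that(3)]
        homology_map_comp[OF p[OF \<open>0 \<le> r\<close>] maps(2) that(3)]
        contiguous_homology_map[OF cx nat[OF that(1,2)] that(3)]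
      by (simp only:)
  qed
  then show ?thesis
    by (simp add: nat_trans_def persistent_homology_def rescale_def linear_homology_map p)
qed

lemma approximated_persistent_homology:
  fixes K :: "real \<Rightarrow> 'v set set" and L :: "real \<Rightarrow> 'w set set"
  assumes K: "complex_diagram K f" and L: "complex_diagram L g" and c: "c \<ge> 1"
    and p: "\<And>r. 0 \<le> r \<Longrightarrow> simplicial (K r) (L (c * r)) (p r)"
    and q: "\<And>r. 0 \<le> r \<Longrightarrow> simplicial (L r) (K (c * r)) (q r)"
    and nat_p: "\<And>r s. 0 \<le> r \<Longrightarrow> r \<le> s \<Longrightarrow>
      contiguous (K r) (L (c * s)) (p s \<circ> f r s) (g (c * r) (c * s) \<circ> p r)"
    and nat_q: "\<And>r s. 0 \<le> r \<Longrightarrow> r \<le> s \<Longrightarrow>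
      contiguous (L r) (K (c * s)) (q s \<circ> g r s) (f (c * r) (c * s) \<circ> q r)"
    and qp: "\<And>r. 0 \<le> r \<Longrightarrow>
      contiguous (K r) (K (c * (c * r))) (q (c * r) \<circ> p r) (f r (c * (c * r)))"
    and pq: "\<And>r. 0 \<le> r \<Longrightarrow>
      contiguous (L r) (L (c * (c * r))) (p (c * r) \<circ> q r) (g r (c * (c * r)))"
  shows "approximated c (persistent_homology n K f :: ('k::field, ('v list \<Rightarrow>\<^sub>0 'k) set) pmodule)
    (persistent_homology n L g :: ('k, ('w list \<Rightarrow>\<^sub>0 'k) set) pmodule)"
proof -
  have cx: "simplicial_complex (K r)" "simplicial_complex (L r)" if "0 \<le> r" for r
    using K L that by (auto simp: complex_diagram_def)
  \<comment> \<open>The triangles rescale twice, while the definition of \<open>approximated\<close>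
    has \<open>c\<^sup>2 * r\<close>.\<close>
  have c2: "c\<^sup>2 * r = c * (c * r)" for r
    by (simp add: power2_eq_square)
  have "homology_map n (K (c * (c * r))) (q (c * r)) (homology_map n (L (c * r)) (p r) x) =
      homology_map n (K (c * (c * r))) (f r (c * (c * r))) x"
    if "0 \<le> r" "x \<in> carrier (homology n (K r))" for r and x :: "('v list \<Rightarrow>\<^sub>0 'k) set"
    using homology_map_comp[OF p[of r] q[of "c * r"], of x n]
      contiguous_homology_map[OF cx(1) cx(1) qp, of r x n] that c by (simp del: o_apply)
  moreover have "homology_map n (L (c * (c * r))) (p (c * r)) (homology_map n (K (c * r)) (q r) y) =
      homology_map n (L (c * (c * r))) (g r (c * (c * r))) y"
    if "0 \<le> r" "y \<in> carrier (homology n (L r))" for r and y :: "('w list \<Rightarrow>\<^sub>0 'k) set"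
    using homology_map_comp[OF q[of r] p[of "c * r"], of y n]
      contiguous_homology_map[OF cx(2) cx(2) pq, of r y n] that c by (simp del: o_apply)
  moreover note nat_trans_persistent_homology[OF K L c p nat_p]
    nat_trans_persistent_homology[OF L K c q nat_q]
  ultimately show ?thesis
    unfolding approximated_def c2
    using c persistence_module_persistent_homology[OF K] persistence_module_persistent_homology[OF L]
    by (intro conjI exI[of _ "\<lambda>r. homology_map n (L (c * r)) (p r)"]
          exI[of _ "\<lambda>r. homology_map n (K (c * r)) (q r)"])
       (simp_all add: persistent_homology_def)
qed

section \<open>Cliques and blocks\<close>

text \<open>The nonnegativity of \<open>r\<close> is essential, as \<open>ennreal\<close> turns
  negative numbers into 0.\<close>

lemma clique_iff:
  assumes "0 \<le> r"
  shows "clique X d r M \<longleftrightarrow> M \<subseteq> X \<and> (\<forall>x\<in>M. \<forall>y\<in>M. d x y \<le> r)"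
  using assms by (simp add: clique_def diam_def SUP_le_iff ennreal_le_iff)

text \<open>Zorn's lemma applies, since any two points of the union of a chain of cliques lie in one
  member.\<close>

lemma clique_subset_max_clique:
  assumes "0 \<le> r" "clique X d r M"
  shows "\<exists>N\<in>max_clique_cover X d r. M \<subseteq> N"
proof -
  let ?A = "{N. clique X d r N \<and> M \<subseteq> N}"
  have "\<exists>N\<in>?A. \<forall>N'\<in>?A. N \<subseteq> N' \<longrightarrow> N' = N"
  proof (rule subset_Zorn_nonempty)
    show "?A \<noteq> {}" using assms by auto
    fix C assume C: "C \<noteq> {}" "subset.chain ?A C"
    then have sub: "C \<subseteq> ?A" and chain: "\<And>S T. S \<in> C \<Longrightarrow> T \<in> C \<Longrightarrow> S \<subseteq> T \<or> T \<subseteq> S"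
      by (auto simp: subset_chain_def)
    have "d x y \<le> r" if xy: "x \<in> \<Union>C" "y \<in> \<Union>C" for x y
    proof -
      obtain S T where "S \<in> C" "T \<in> C" "x \<in> S" "y \<in> T" using xy by blast
      then obtain U where "U \<in> C" "x \<in> U" "y \<in> U" using chain by blast
      then show ?thesis using sub by (auto simp: clique_iff[OF assms(1)])
    qed
    then show "\<Union>C \<in> ?A"
      using sub C(1) unfolding clique_iff[OF assms(1)] by blast
  qed
  then obtain N where N: "N \<in> ?A" and max: "\<forall>N'\<in>?A. N \<subseteq> N' \<longrightarrow> N' = N"
    by (rule bexE)
  have "\<not> N \<subset> N'" if "clique X d r N'" for N'
  proof
    assume "N \<subset> N'"
    moreover from this have "N' \<in> ?A" using N that by auto
    ultimately show False using max by (metis psubset_eq)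
  qed
  then have "N \<in> max_clique_cover X d r" using N by (simp add: max_clique_cover_def)
  then show ?thesis using N by blast
qed

text \<open>Every clique extends to a maximal one, so the maximal cliques have the same co-nerve as
  all cliques.\<close>

lemma mem_VR_complex:
  assumes "0 \<le> r"
  shows "\<sigma> \<in> conerve (max_clique_cover X d r) \<longleftrightarrow> finite \<sigma> \<and> \<sigma> \<noteq> {} \<and> clique X d r \<sigma>"
proof -
  have "clique X d r \<sigma>" if N: "N \<in> max_clique_cover X d r" "\<sigma> \<subseteq> N" for N
  proof -
    have "clique X d r N" using N by (simp add: max_clique_cover_def)
    then show ?thesis using N(2) unfolding clique_iff[OF assms] by blast
  qed
  then have "(\<exists>N\<in>max_clique_cover X d r. \<sigma> \<subseteq> N) \<longleftrightarrow> clique X d r \<sigma>"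
    using clique_subset_max_clique[OF assms, of X d \<sigma>] by blast
  then show ?thesis
    by (simp add: conerve_def)
qed

text \<open>Maximality may be dropped as for the Vietoris--Rips complex: enlarging a clique enlarges
  its set of blocks.\<close>

lemma mem_quotient_VR_complex:
  assumes "0 \<le> r"
  shows "\<tau> \<in> conerve (quotient_cover (max_clique_cover X d) P r) \<longleftrightarrow>
    finite \<tau> \<and> \<tau> \<noteq> {} \<and> (\<exists>M. clique X d r M \<and> \<tau> \<subseteq> block_of P r ` M)"
proof -
  have "(\<exists>N\<in>max_clique_cover X d r. \<tau> \<subseteq> block_of P r ` N) \<longleftrightarrow>
      (\<exists>M. clique X d r M \<and> \<tau> \<subseteq> block_of P r ` M)"
  proof
    assume "\<exists>N\<in>max_clique_cover X d r. \<tau> \<subseteq> block_of P r ` N"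
    then show "\<exists>M. clique X d r M \<and> \<tau> \<subseteq> block_of P r ` M"
      by (auto simp: max_clique_cover_def)
  next
    assume "\<exists>M. clique X d r M \<and> \<tau> \<subseteq> block_of P r ` M"
    then obtain M where M: "clique X d r M" "\<tau> \<subseteq> block_of P r ` M" by (elim exE conjE)
    obtain N where N: "N \<in> max_clique_cover X d r" "M \<subseteq> N"
      using clique_subset_max_clique[OF assms M(1)] by (elim bexE)
    have "\<tau> \<subseteq> block_of P r ` N"
      using M(2) image_mono[OF N(2)] by (rule subset_trans)
    then show "\<exists>N\<in>max_clique_cover X d r. \<tau> \<subseteq> block_of P r ` N"
      using N(1) by (rule bexI)
  qed
  then show ?thesis
    by (simp add: conerve_def quotient_cover_def)
qed

lemma simplicial_complex_conerve: "simplicial_complex (conerve \<U>)"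
  by (auto simp: simplicial_complex_def conerve_def intro: finite_subset)

section \<open>Blocks, representatives and the maps between the two complexes\<close>

locale metric_clique_partition = Metric_space X d
  for X :: "'a set" and d :: "'a \<Rightarrow> 'a \<Rightarrow> real" +
  fixes P :: "real \<Rightarrow> 'a set set"
  assumes partition: "persistent_clique_partition X d P"
begin

abbreviation VR :: "real \<Rightarrow> 'a set set" where
  "VR r \<equiv> conerve (max_clique_cover X d r)"

abbreviation quotient_VR :: "real \<Rightarrow> 'a set set set" where
  "quotient_VR r \<equiv> conerve (quotient_cover (max_clique_cover X d) P r)"

text \<open>The choice depends on the block alone and not on the scale. Nested blocks need not share
  their chosen points, so squares with this map commute only up to contiguity.\<close>

definition representative :: "'a set \<Rightarrow> 'a" where
  "representative C = (SOME x. x \<in> C)"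

lemma partition_on: "0 \<le> r \<Longrightarrow> partition_on X (P r)"
  using partition by (simp add: persistent_clique_partition_def)

lemma block_unique:
  assumes "0 \<le> r" "C \<in> P r" "D \<in> P r" "x \<in> C" "x \<in> D"
  shows "C = D"
  using disjointD[OF partition_onD2[OF partition_on] assms(2,3)] assms by auto

lemma block_refine: "0 \<le> r \<Longrightarrow> r \<le> s \<Longrightarrow> C \<in> P r \<Longrightarrow> \<exists>D\<in>P s. C \<subseteq> D"
  using partition by (simp add: persistent_clique_partition_def)

lemma block_of_eq:
  assumes "0 \<le> r" "C \<in> P r" "x \<in> C"
  shows "block_of P r x = C"
  unfolding block_of_def by (rule the_equality) (use assms block_unique in auto)

lemma block_of: "0 \<le> r \<Longrightarrow> x \<in> X \<Longrightarrow> block_of P r x \<in> P r \<and> x \<in> block_of P r x"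
  using partition_onD1[OF partition_on] block_of_eq by (metis UnionE)

lemma block_subset: "0 \<le> r \<Longrightarrow> C \<in> P r \<Longrightarrow> C \<subseteq> X"
  using partition_onD1[OF partition_on] by blast

lemma representative_mem: "0 \<le> r \<Longrightarrow> C \<in> P r \<Longrightarrow> representative C \<in> C"
  unfolding representative_def using partition_onD3[OF partition_on] by (metis some_in_eq)

lemma block_of_mono:
  assumes "0 \<le> r" "r \<le> s" "x \<in> X"
  shows "block_of P r x \<subseteq> block_of P s x"
proof -
  have r: "block_of P r x \<in> P r" "x \<in> block_of P r x" using block_of assms by auto
  then obtain D where "D \<in> P s" "block_of P r x \<subseteq> D"
    using block_refine assms by meson
  then show ?thesis using block_of_eq[of s D x] r assms by auto
qed

text \<open>A block at scale \<open>s\<close> that contains the block of \<open>x\<close> contains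
  \<open>x\<close>, hence is unique. Through this rule \<open>block_map\<close> is computed at
  points of \<open>X\<close>.\<close>

lemma block_map_block_of:
  assumes "0 \<le> r" "r \<le> s" "x \<in> X"
  shows "block_map P r s (block_of P r x) = block_of P s x"
  unfolding block_map_def
proof (rule the_equality)
  show "block_of P s x \<in> P s \<and> block_of P r x \<subseteq> block_of P s x"
    using block_of block_of_mono assms by auto
  show "D = block_of P s x" if "D \<in> P s \<and> block_of P r x \<subseteq> D" for D
    using that block_of[of r x] block_of_eq[of s D x] assms by auto
qed

lemma dist_in_block:
  assumes "0 \<le> r" "C \<in> P r" "x \<in> C" "y \<in> C"
  shows "d x y \<le> r"
proof -
  have "clique X d r C"
    using assms partition block_subset by (auto simp: clique_def persistent_clique_partition_def)
  then show ?thesis using assms by (simp add: clique_iff)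
qed

text \<open>The triangle inequality along \<open>u\<close>, \<open>x\<close>, \<open>y\<close>,
  \<open>v\<close>; each of the two blocks contributes at most \<open>s\<close>.\<close>

lemma dist_block_of:
  assumes "0 \<le> s" "x \<in> X" "y \<in> X" "u \<in> block_of P s x" "v \<in> block_of P s y"
  shows "d u v \<le> 2 * s + d x y"
proof -
  have uv: "u \<in> X" "v \<in> X" using assms block_of block_subset by blast+
  have "d u x \<le> s" "d y v \<le> s" using assms block_of dist_in_block by blast+
  moreover have "d u v \<le> d u x + d x v" "d x v \<le> d x y + d y v"
    using triangle assms uv by auto
  ultimately show ?thesis by linarith
qed

text \<open>The source of the constant 3: \<open>2 * s + r\<close> is at most \<open>3 * s\<close>
  when \<open>r \<le> s\<close>. Every claim that \<open>representative\<close> lands in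
  \<open>VR\<close> uses this estimate.\<close>

lemma simplex_near_clique:
  assumes r: "0 \<le> r" and s: "0 \<le> s" and M: "clique X d r M" and \<sigma>: "finite \<sigma>" "\<sigma> \<noteq> {}"
    and near: "\<And>u. u \<in> \<sigma> \<Longrightarrow> \<exists>x\<in>M. u \<in> block_of P s x" and t: "2 * s + r \<le> t"
  shows "\<sigma> \<in> VR t"
proof -
  have MX: "M \<subseteq> X" using M by (simp add: clique_def)
  have "u \<in> X" if u: "u \<in> \<sigma>" for u
    using near[OF u] MX block_of block_subset s by blast
  moreover have "d u v \<le> t" if uv: "u \<in> \<sigma>" "v \<in> \<sigma>" for u v
  proof -
    obtain x y where xy: "x \<in> M" "y \<in> M" "u \<in> block_of P s x" "v \<in> block_of P s y"
      using near uv by blast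
    then have "d u v \<le> 2 * s + d x y" using MX by (intro dist_block_of s) auto
    moreover have "d x y \<le> r" using M xy r by (simp add: clique_iff)
    ultimately show ?thesis using t by linarith
  qed
  ultimately show ?thesis
    using \<sigma> r s t by (auto simp: mem_VR_complex clique_iff)
qed

lemma quotient_VR_E:
  assumes "0 \<le> r" "\<tau> \<in> quotient_VR r"
  obtains M where "clique X d r M" "M \<subseteq> X" "\<tau> \<subseteq> block_of P r ` M" "finite \<tau>" "\<tau> \<noteq> {}"
  using assms by (auto simp: mem_quotient_VR_complex clique_def)

lemma clique_mono: "clique X d r M \<Longrightarrow> r \<le> s \<Longrightarrow> clique X d s M"
  unfolding clique_def by (meson ennreal_leI order_trans)

lemma vertex_quotient_VR:
  assumes "0 \<le> r" "\<tau> \<in> quotient_VR r" "C \<in> \<tau>"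
  obtains x where "x \<in> X" "C = block_of P r x"
proof (rule quotient_VR_E[OF assms(1,2)])
  fix M assume "M \<subseteq> X" "\<tau> \<subseteq> block_of P r ` M"
  then show ?thesis using assms(3) that by auto
qed

lemma simplicial_VR:
  assumes "0 \<le> r" "r \<le> s"
  shows "simplicial (VR r) (VR s) (\<lambda>x. x)"
  using assms clique_mono by (auto simp: simplicial_def mem_VR_complex)

lemma simplicial_block_map:
  assumes "0 \<le> r" "r \<le> s"
  shows "simplicial (quotient_VR r) (quotient_VR s) (block_map P r s)"
  unfolding simplicial_def
proof
  fix \<tau> assume \<tau>: "\<tau> \<in> quotient_VR r"
  obtain M where M: "clique X d r M" "M \<subseteq> X" "\<tau> \<subseteq> block_of P r ` M" "finite \<tau>" "\<tau> \<noteq> {}"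
    by (rule quotient_VR_E[OF assms(1) \<tau>])
  \<comment> \<open>The block of a point goes to the block of the same point at scale
    \<open>s\<close>.\<close>
  have *: "block_map P r s ` block_of P r ` M = block_of P s ` M"
    unfolding image_image using M(2) assms by (intro image_cong) (auto simp: block_map_block_of)
  have "block_map P r s ` \<tau> \<subseteq> block_of P s ` M"
    using image_mono[OF M(3), of "block_map P r s"] by (simp only: *)
  moreover have "clique X d s M" using M(1) assms(2) by (rule clique_mono)
  moreover have "0 \<le> s" using assms by simp
  ultimately show "block_map P r s ` \<tau> \<in> quotient_VR s"
    using M(4,5) by (simp add: mem_quotient_VR_complex exI[of _ M])
qed

text \<open>The target scale is left free, because the squares also need the map from scale
  \<open>r\<close> to scale \<open>3 * s\<close>.\<close>

lemma simplicial_block_of: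
  assumes "0 \<le> r" "r \<le> s"
  shows "simplicial (VR r) (quotient_VR s) (block_of P s)"
  unfolding simplicial_def
proof
  fix \<sigma> assume "\<sigma> \<in> VR r"
  then have "finite \<sigma>" "\<sigma> \<noteq> {}" "clique X d s \<sigma>"
    using assms clique_mono[of r \<sigma> s] by (auto simp: mem_VR_complex)
  then show "block_of P s ` \<sigma> \<in> quotient_VR s"
    using assms by (subst mem_quotient_VR_complex) auto
qed

lemma representative_block_of:
  assumes "0 \<le> r" "r \<le> s" "x \<in> X"
  shows "representative (block_of P r x) \<in> block_of P s x"
  using block_of_mono[OF assms] representative_mem[of r] block_of[of r x] assms by blast

lemma simplicial_representative:
  assumes "0 \<le> r"
  shows "simplicial (quotient_VR r) (VR (3 * r)) representative"
  unfolding simplicial_def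
proof
  fix \<tau> assume \<tau>: "\<tau> \<in> quotient_VR r"
  obtain M where M: "clique X d r M" "M \<subseteq> X" "\<tau> \<subseteq> block_of P r ` M" "finite \<tau>" "\<tau> \<noteq> {}"
    by (rule quotient_VR_E[OF assms(1) \<tau>])
  show "representative ` \<tau> \<in> VR (3 * r)"
  \<comment> \<open>Here clique and blocks have the same scale, and \<open>2 * r + r\<close> is
    \<open>3 * r\<close>.\<close>
  proof (rule simplex_near_clique[of r r M])
    fix u assume "u \<in> representative ` \<tau>"
    then obtain C where "C \<in> \<tau>" "u = representative C" by (elim imageE)
    moreover from this M(3) obtain x where x: "x \<in> M" "C = block_of P r x" by (meson imageE subsetD)
    ultimately show "\<exists>x\<in>M. u \<in> block_of P r x"
      using representative_block_of[OF assms order_refl, of x] M(2) by (intro bexI[of _ x]) auto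
  qed (use M assms in simp_all)
qed

section \<open>The two diagrams, their squares and triangles\<close>

lemma complex_diagram_VR: "complex_diagram VR (\<lambda>r s x. x)"
  unfolding complex_diagram_def
  by (auto simp: simplicial_complex_conerve simplicial_VR comp_def intro!: contiguous_if_eq)

lemma complex_diagram_quotient_VR: "complex_diagram quotient_VR (block_map P)"
  unfolding complex_diagram_def
proof (intro conjI allI impI simplicial_complex_conerve)
  fix r :: real assume r: "0 \<le> r"
  show "contiguous (quotient_VR r) (quotient_VR r) (block_map P r r) (\<lambda>x. x)"
    using r simplicial_block_map
    by (intro contiguous_if_eq) (auto elim!: vertex_quotient_VR[OF r] simp: block_map_block_of)
next
  fix r s t :: real assume *: "0 \<le> r \<and> r \<le> s \<and> s \<le> t"
  then have "simplicial (quotient_VR r) (quotient_VR t) (block_map P r t)"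
    by (intro simplicial_block_map) auto
  then show "contiguous (quotient_VR r) (quotient_VR t)
      (block_map P s t \<circ> block_map P r s) (block_map P r t)"
    using * by (intro contiguous_sym[OF contiguous_if_eq])
      (auto elim!: vertex_quotient_VR[rotated] simp: block_map_block_of)
qed (auto simp: simplicial_block_map)

text \<open>If \<open>C\<close> is the block of \<open>x\<close> at scale \<open>r\<close>, then
  both representatives lie in the block of \<open>x\<close> at scale \<open>s\<close>.\<close>

lemma contiguous_representative_block_map:
  assumes r: "0 \<le> r" "r \<le> s"
  shows "contiguous (quotient_VR r) (VR (3 * s)) (representative \<circ> block_map P r s) representative"
  unfolding contiguous_def
proof
  fix \<tau> assume \<tau>: "\<tau> \<in> quotient_VR r"
  obtain M where M: "clique X d r M" "M \<subseteq> X" "\<tau> \<subseteq> block_of P r ` M" "finite \<tau>" "\<tau> \<noteq> {}"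
    by (rule quotient_VR_E[OF r(1) \<tau>])
  show "(representative \<circ> block_map P r s) ` \<tau> \<union> representative ` \<tau> \<in> VR (3 * s)"
  proof (rule simplex_near_clique[of r s M])
    fix u assume "u \<in> (representative \<circ> block_map P r s) ` \<tau> \<union> representative ` \<tau>"
    then obtain C where C: "C \<in> \<tau>" "u = representative (block_map P r s C) \<or> u = representative C"
      by auto
    with M(3) obtain x where x: "x \<in> M" "C = block_of P r x" by (meson imageE subsetD)
    then have "u \<in> block_of P s x"
      using C(2) M(2) r representative_block_of[of r s x] representative_block_of[of s s x]
      by (auto simp: block_map_block_of)
    then show "\<exists>x\<in>M. u \<in> block_of P s x" using x(1) by blast
  qed (use M r in simp_all)
qed

lemma contiguous_representative_block_of:
  assumes r: "0 \<le> r"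
  shows "contiguous (VR r) (VR (3 * (3 * r))) (representative \<circ> block_of P (3 * r)) (\<lambda>x. x)"
  unfolding contiguous_def
proof
  fix \<sigma> assume "\<sigma> \<in> VR r"
  then have M: "clique X d r \<sigma>" "\<sigma> \<subseteq> X" "finite \<sigma>" "\<sigma> \<noteq> {}"
    using r by (auto simp: mem_VR_complex clique_def)
  show "(representative \<circ> block_of P (3 * r)) ` \<sigma> \<union> (\<lambda>x. x) ` \<sigma> \<in> VR (3 * (3 * r))"
  \<comment> \<open>The blocks have scale \<open>3 * r\<close>, so the bound is
    \<open>7 * r\<close>, which is at most \<open>9 * r\<close>.\<close>
  proof (rule simplex_near_clique[of r "3 * r" \<sigma>])
    fix u assume "u \<in> (representative \<circ> block_of P (3 * r)) ` \<sigma> \<union> (\<lambda>x. x) ` \<sigma>"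
    then obtain x where x: "x \<in> \<sigma>" "u = representative (block_of P (3 * r) x) \<or> u = x"
      by auto
    then have "u \<in> block_of P (3 * r) x"
      using M(2) r representative_block_of[of "3 * r" "3 * r" x] block_of[of "3 * r" x] by auto
    then show "\<exists>x\<in>\<sigma>. u \<in> block_of P (3 * r) x" using x(1) by blast
  qed (use M r in simp_all)
qed

text \<open>This square commutes strictly on vertices: both composites give the block of
  \<open>x\<close> at scale \<open>3 * s\<close>.\<close>

lemma contiguous_block_of_block_map:
  assumes r: "0 \<le> r" "r \<le> s"
  shows "contiguous (VR r) (quotient_VR (3 * s)) (block_of P (3 * s))
    (block_map P (3 * r) (3 * s) \<circ> block_of P (3 * r))"
proof (rule contiguous_if_eq)
  show "simplicial (VR r) (quotient_VR (3 * s)) (block_of P (3 * s))"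
    using r by (intro simplicial_block_of) auto
  fix \<sigma> x assume "\<sigma> \<in> VR r" "x \<in> \<sigma>"
  then have "x \<in> X" using r by (auto simp: mem_VR_complex clique_def)
  then show "block_of P (3 * s) x = (block_map P (3 * r) (3 * s) \<circ> block_of P (3 * r)) x"
    using r by (simp add: block_map_block_of)
qed

text \<open>A strict identity on vertices: the representative of \<open>C\<close> lies in the block
  that contains \<open>C\<close> at the later scale.\<close>

lemma contiguous_block_of_representative:
  assumes r: "0 \<le> r"
  shows "contiguous (quotient_VR r) (quotient_VR (3 * (3 * r)))
    (block_of P (3 * (3 * r)) \<circ> representative) (block_map P r (3 * (3 * r)))"
proof (rule contiguous_sym[OF contiguous_if_eq])
  show "simplicial (quotient_VR r) (quotient_VR (3 * (3 * r))) (block_map P r (3 * (3 * r)))"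
    using r by (intro simplicial_block_map) auto
  fix \<tau> C assume \<tau>: "\<tau> \<in> quotient_VR r" "C \<in> \<tau>"
  obtain x where x: "x \<in> X" "C = block_of P r x" by (rule vertex_quotient_VR[OF r \<tau>])
  have "block_of P (3 * (3 * r)) (representative C) = block_of P (3 * (3 * r)) x"
    using x r representative_block_of[of r "3 * (3 * r)" x] block_of[of "3 * (3 * r)" x]
    by (intro block_of_eq) auto
  then show "block_map P r (3 * (3 * r)) C = (block_of P (3 * (3 * r)) \<circ> representative) C"
    using x r by (simp add: block_map_block_of)
qed

lemma approximated_VR:
  "approximated 3
     (VR_homology n X d :: ('k::field, ('a list \<Rightarrow>\<^sub>0 'k) set) pmodule)
     (quotient_VR_homology n X d P :: ('k, ('a set list \<Rightarrow>\<^sub>0 'k) set) pmodule)"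
  unfolding VR_homology_def quotient_VR_homology_def
\<comment> \<open>Only \<open>p\<close> involves the scale: it takes the block at the target scale
  \<open>3 * r\<close>, whereas representatives are chosen from the blocks alone.\<close>
proof (rule approximated_persistent_homology[where p = "\<lambda>r. block_of P (3 * r)" and q = "\<lambda>r. representative"])
  fix r s :: real assume "0 \<le> r" "r \<le> s"
  then show "contiguous (VR r) (quotient_VR (3 * s)) (block_of P (3 * s) \<circ> (\<lambda>x. x))
      (block_map P (3 * r) (3 * s) \<circ> block_of P (3 * r))"
    "contiguous (quotient_VR r) (VR (3 * s)) (representative \<circ> block_map P r s)
      ((\<lambda>x. x) \<circ> representative)"
    using contiguous_block_of_block_map contiguous_representative_block_map by (simp_all add: comp_def)
qed (use contiguous_representative_block_of contiguous_block_of_representative in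
    \<open>auto intro: complex_diagram_VR complex_diagram_quotient_VR simplicial_block_of
      simplicial_representative\<close>)

end

theorem corollary4p15:
  fixes X :: "'a set" and d :: "'a \<Rightarrow> 'a \<Rightarrow> real" and P :: "real \<Rightarrow> 'a set set" and n :: nat
  assumes "Metric_space X d"
    and "persistent_clique_partition X d P"
  shows "approximated 3
           (VR_homology n X d :: ('k::field, ('a list \<Rightarrow>\<^sub>0 'k) set) pmodule)
           (quotient_VR_homology n X d P :: ('k, ('a set list \<Rightarrow>\<^sub>0 'k) set) pmodule)"
proof -
  interpret Metric_space X d by (rule assms)
  interpret metric_clique_partition X d P by unfold_locales (rule assms)
  show ?thesis by (rule approximated_VR)
qed

end
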